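(* Let $\mathcal X$ and $\mathcal F$ be the unit balls of a finite-dimensional Euclidean space, with loss $\ell(f,x)=\langle f,x\rangle$, and let $D$ be the uniform distribution on the surface of the unit sphere. Consider the randomized algorithm that at each round $t$ freshly draws $x_{t+1},\dots,x_T\sim D$ i.i.d. and picks $$f_t=\frac{-\sum_{i=1}^{t-1}x_i+C\sum_{i=t+1}^Tx_i}{\sqrt{\big\|-\sum_{i=1}^{t-1}x_i+C\sum_{i=t+1}^Tx_i\big\|_2^2+1}},\qquad C=4\sqrt2,$$ where $x_1,\dots,x_{t-1}$ are Nature's past moves. Then the expected regret satisfies $$\mathbb E[\mathbf{Reg}_T]\le C\,\mathbb E_{x_1,\dots,x_T\sim D}\Big\|\sum_{t=1}^Tx_t\Big\|_2\le4\sqrt{2T}.$$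
   Context: Online linear optimization: on each round $t=1,\dots,T$ the learner picks $f_t\in\mathcal F$ (randomized) and Nature simultaneously picks $x_t\in\mathcal X$ (Nature may depend on the past moves of both players but not on the learner's fresh randomness of round $t$). $\mathbf{Reg}_T=\sum_{t=1}^T\langle f_t,x_t\rangle-\inf_{f\in\mathcal F}\sum_{t=1}^T\langle f,x_t\rangle$. *)

theory Defs
  imports "HOL-Probability.Probability"
begin

text \<open>
  The library has no surface measure. The uniform distribution on the unit sphere is taken as the
  cone measure: the radial projection of the uniform distribution on the unit ball, so that
  a Borel set of directions has mass proportional to the volume of the cone over it. In dimension
  one this is the fair coin on the two unit vectors. The value \<open>sgn 0 = 0\<close> matters only on a null
  set.
\<close>

definition uniform_sphere :: "'a::euclidean_space measure" where
  "uniform_sphere = distr (uniform_measure lborel (ball 0 1)) borel sgn"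

lemma sgn_borel_measurable: "(sgn :: 'a::euclidean_space \<Rightarrow> 'a) \<in> borel_measurable borel"
  unfolding sgn_div_norm[abs_def] by measurable

lemma sets_uniform_sphere [simp, measurable_cong]:
  "sets (uniform_sphere :: 'a::euclidean_space measure) = sets borel"
  by (simp add: uniform_sphere_def)

lemma emeasure_unit_ball:
  "emeasure lborel (ball (0::'a::euclidean_space) 1) \<noteq> 0"
  "emeasure lborel (ball (0::'a::euclidean_space) 1) \<noteq> \<infinity>"
proof -
  show "emeasure lborel (ball (0::'a) 1) \<noteq> \<infinity>"
    using emeasure_bounded_finite[OF bounded_ball, of "0::'a" 1] by (simp add: less_top)
  show "emeasure lborel (ball (0::'a) 1) \<noteq> 0"
    using content_ball_pos[of 1 "0::'a"] by (auto simp: measure_def)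
qed

lemma prob_space_uniform_sphere: "prob_space (uniform_sphere :: 'a::euclidean_space measure)"
proof -
  interpret prob_space "uniform_measure lborel (ball (0::'a) 1)"
    by (rule prob_space_uniform_measure) (use emeasure_unit_ball in auto)
  show ?thesis
    unfolding uniform_sphere_def by (rule prob_space_distr) (simp add: sgn_borel_measurable)
qed

lemma AE_uniform_sphere: "AE x in (uniform_sphere :: 'a::euclidean_space measure). x \<in> sphere 0 1"
proof -
  have "AE x in lborel. x \<noteq> (0::'a)"
    by (rule AE_lborel_singleton)
  then have "AE x in uniform_measure lborel (ball (0::'a) 1). sgn x \<in> sphere 0 1"
    by (intro AE_uniform_measureI) (auto simp: norm_sgn)
  then show ?thesis
    unfolding uniform_sphere_def by (subst AE_distr_iff) (auto simp: sgn_borel_measurable)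
qed

text \<open>
  \<open>x\<close> lists Nature's moves and \<open>z\<close> the draws made in round \<open>t\<close>; only \<open>x i\<close> with \<open>i < t\<close> and
  \<open>z i\<close> with \<open>t < i \<le> T\<close> are used.
\<close>

definition learner_move ::
  "real \<Rightarrow> nat \<Rightarrow> nat \<Rightarrow> (nat \<Rightarrow> 'a) \<Rightarrow> (nat \<Rightarrow> 'a) \<Rightarrow> 'a::euclidean_space" where
  "learner_move C T t x z =
     (let v = - (\<Sum>i\<in>{1..<t}. x i) + C *\<^sub>R (\<Sum>i\<in>{t<..T}. z i)
      in v /\<^sub>R sqrt ((norm v)\<^sup>2 + 1))"

definition regret :: "nat \<Rightarrow> (nat \<Rightarrow> 'a) \<Rightarrow> (nat \<Rightarrow> 'a) \<Rightarrow> 'a::euclidean_space set \<Rightarrow> real" where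
  "regret T f x F = (\<Sum>t\<in>{1..T}. f t \<bullet> x t) - (INF g\<in>F. \<Sum>t\<in>{1..T}. g \<bullet> x t)"

text \<open>
  A play of the game on a probability space \<open>M\<close>: \<open>X t\<close> is Nature's move in round \<open>t\<close> and
  \<open>Z t i\<close>, for \<open>t < i \<le> T\<close>, are the learner's draws of round \<open>t\<close>. Nature may be adaptive and
  randomized: the only restriction on its move is that the draws of round \<open>t\<close> are independent
  of \<open>X 1, \<dots>, X t\<close> and all earlier draws jointly (independence of the generated sigma-algebras,
  as \<open>indep_var\<close> needs both random variables to have the same range type). The learner's earlier moves are functions of
  these, so \<open>X t\<close> may depend on the past moves of both players and on private randomness of Nature.
\<close>

locale online_game = prob_space M
  for M :: "'w measure" +
  fixes T :: nat
    and X :: "nat \<Rightarrow> 'w \<Rightarrow> 'a::euclidean_space"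
    and Z :: "nat \<Rightarrow> nat \<Rightarrow> 'w \<Rightarrow> 'a"
  assumes nature_random: "\<And>t. t \<in> {1..T} \<Longrightarrow> random_variable borel (X t)"
    and nature_ball: "\<And>t \<omega>. t \<in> {1..T} \<Longrightarrow> \<omega> \<in> space M \<Longrightarrow> X t \<omega> \<in> cball 0 1"
    and draw_random: "\<And>t i. t \<in> {1..T} \<Longrightarrow> i \<in> {t<..T} \<Longrightarrow> random_variable borel (Z t i)"
    and draw_law: "\<And>t i. t \<in> {1..T} \<Longrightarrow> i \<in> {t<..T} \<Longrightarrow> distr M borel (Z t i) = uniform_sphere"
    and draw_indep: "\<And>t. t \<in> {1..T} \<Longrightarrow> indep_vars (\<lambda>_. borel) (Z t) {t<..T}"
    and draw_fresh: "\<And>t. t \<in> {1..T} \<Longrightarrow>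
      indep_set
        (sets (vimage_algebra (space M)
          (\<lambda>\<omega>. (\<lambda>s\<in>{1..t}. X s \<omega>, \<lambda>p\<in>(SIGMA s:{1..<t}. {s<..T}). Z (fst p) (snd p) \<omega>))
          (PiM {1..t} (\<lambda>_. borel) \<Otimes>\<^sub>M PiM (SIGMA s:{1..<t}. {s<..T}) (\<lambda>_. borel))))
        (sets (vimage_algebra (space M)
          (\<lambda>\<omega>. \<lambda>i\<in>{t<..T}. Z t i \<omega>)
          (PiM {t<..T} (\<lambda>_. borel))))"

end

theory Submission
  imports Defs
begin

text \<open>
  By independence of the draws of round \<open>t\<close> from Nature's moves up to round \<open>t\<close>, the draws may be
  integrated out first, and it suffices to bound
  \<open>\<Sum>t. E (f\<^sub>t \<bullet> x\<^sub>t) + norm (\<Sum>t. x\<^sub>t)\<close> for every fixed sequence of moves in the ball.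

  In dimension at least two the potential \<open>E norm (- \<Sum>i\<le>t. x\<^sub>i + C * \<Sum>i>t. z\<^sub>i)\<close> drops by at
  least the loss in every round: with \<open>f = v / sqrt (norm v ^ 2 + 1)\<close> one has
  \<open>f \<bullet> x + norm (v - x) \<le> sqrt (norm v ^ 2 + 1) \<le> E norm (v + C * z)\<close>, where the second inequality
  pairs \<open>z\<close> with \<open>- z\<close> and uses that \<open>z\<close> has on average at most half of its squared length in the
  direction of \<open>v\<close>.

  In dimension one \<open>z\<close> is a fair sign and the second inequality fails. There the norm in the potential
  is replaced by \<open>hyp v = sqrt (v ^ 2 + 1)\<close>, for which the one-step inequality
  \<open>f * x + hyp (v - x) \<le> (hyp (v + C) + hyp (v - C)) / 2\<close> holds, even with room to spare when
  \<open>\<bar>v\<bar> \<le> C\<close>. The initial value of the new potential is too large by \<open>E (hyp (C * R) - \<bar>C * R\<bar>)\<close>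
  for the sum \<open>R\<close> of \<open>T\<close> fair signs; the room gained in the first rounds compensates for this.
\<close>

section \<open>Symmetries of the uniform distribution on the sphere\<close>

text \<open>\<open>U\<close> maps the unit ball onto itself in measure and commutes with
  \<open>sgn\<close>, so invariance of Lebesgue measure passes first to the uniform law on the ball
  and then to its radial projection. It is applied to sign changes and coordinate permutations,
  where \<open>inv\<close> can be checked directly.\<close>

lemma uniform_sphere_isometry:
  fixes U :: "'a::euclidean_space \<Rightarrow> 'a"
  assumes lin: "linear U" and iso: "\<And>x. norm (U x) = norm x"
    and inv: "distr lborel borel U = lborel"
  shows "distr uniform_sphere borel U = uniform_sphere"
proof -
  have [measurable]: "U \<in> borel_measurable borel" "(sgn :: 'a \<Rightarrow> 'a) \<in> borel_measurable borel"
    using lin by (auto intro!: borel_measurable_continuous_onI linear_continuous_on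
        simp: linear_conv_bounded_linear sgn_borel_measurable)
  let ?B = "uniform_measure lborel (ball (0::'a) 1)"
  have ball: "distr ?B borel U = ?B"
  proof (rule measure_eqI)
    fix A assume "A \<in> sets (distr ?B borel U)"
    then have [measurable]: "A \<in> sets borel" by simp
    have [measurable]: "U -` A \<in> sets borel"
      using measurable_sets_borel[of U borel A] by simp
    have "emeasure (distr ?B borel U) A
        = emeasure lborel (ball 0 1 \<inter> (U -` A)) / emeasure lborel (ball (0::'a) 1)"
      by (subst emeasure_distr) auto
    also have "ball 0 1 \<inter> (U -` A) = U -` (ball 0 1 \<inter> A)"
      by (auto simp: iso)
    also have "emeasure lborel (U -` (ball 0 1 \<inter> A)) = emeasure (distr lborel borel U) (ball 0 1 \<inter> A)"
      by (subst emeasure_distr) auto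
    finally show "emeasure (distr ?B borel U) A = emeasure ?B A"
      by (simp add: inv)
  qed simp
  have "U \<circ> sgn = sgn \<circ> U"
    by (auto simp: fun_eq_iff sgn_div_norm iso linear_scale[OF lin])
  then have "distr uniform_sphere borel U = distr (distr ?B borel U) borel sgn"
    by (simp add: uniform_sphere_def distr_distr)
  then show ?thesis
    by (simp add: ball uniform_sphere_def)
qed

lemma distr_lborel_uminus: "distr lborel borel uminus = (lborel :: 'a::euclidean_space measure)"
  using lborel_affine[of "-1" "0::'a"] by (simp add: density_1)

lemma distr_uniform_sphere_uminus:
  "distr uniform_sphere borel uminus = (uniform_sphere :: 'a::euclidean_space measure)"
  by (rule uniform_sphere_isometry) (auto simp: distr_lborel_uminus linear_iff)

lemma norm_eq_coordinates:
  fixes x y :: "'a::euclidean_space"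
  assumes "(\<Sum>b\<in>Basis. (x \<bullet> b)\<^sup>2) = (\<Sum>b\<in>Basis. (y \<bullet> b)\<^sup>2)"
  shows "norm x = norm y"
  unfolding norm_eq_sqrt_inner using assms
  by (subst (1 2) euclidean_inner) (simp add: power2_eq_square)

lemma distr_uniform_sphere_flip:
  fixes s :: "'a::euclidean_space \<Rightarrow> real"
  assumes "\<And>b. b \<in> Basis \<Longrightarrow> s b \<in> {-1, 1}"
  shows "distr uniform_sphere borel (\<lambda>x. \<Sum>b\<in>Basis. (s b * (x \<bullet> b)) *\<^sub>R b) = uniform_sphere"
proof (rule uniform_sphere_isometry)
  have 1: "\<bar>s b\<bar> = 1" "(s b)\<^sup>2 = 1" "s b \<noteq> 0" if "b \<in> Basis" for b using assms[OF that] by auto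
  show "linear (\<lambda>x. \<Sum>b\<in>Basis. (s b * (x \<bullet> b)) *\<^sub>R b)"
    by (auto simp: linear_iff inner_add_left algebra_simps sum.distrib scaleR_sum_right)
  show "norm (\<Sum>b\<in>Basis. (s b * (x \<bullet> b)) *\<^sub>R b) = norm x" for x
    by (rule norm_eq_coordinates) (simp add: power_mult_distrib 1)
  show "distr lborel borel (\<lambda>x. \<Sum>b\<in>Basis. (s b * (x \<bullet> b)) *\<^sub>R b) = lborel"
    using lborel_affine_euclidean[of s 0] 1 by (simp add: density_1)
qed

text \<open>For Lebesgue measure it is enough to compare boxes: the preimage of a box is again a
  box, with permuted side lengths.\<close>

lemma distr_uniform_sphere_permute:
  fixes p :: "'a::euclidean_space \<Rightarrow> 'a"
  assumes p: "bij_betw p Basis Basis"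
  shows "distr uniform_sphere borel (\<lambda>x. \<Sum>b\<in>Basis. (x \<bullet> p b) *\<^sub>R b) = uniform_sphere"
proof (rule uniform_sphere_isometry)
  let ?U = "\<lambda>x. \<Sum>b\<in>Basis. (x \<bullet> p b) *\<^sub>R b"
  have reindex: "(\<Sum>b\<in>Basis. h (p b)) = (\<Sum>b\<in>Basis. h b)" for h :: "'a \<Rightarrow> real"
    using p by (rule sum.reindex_bij_betw)
  show lin: "linear ?U"
    by (auto simp: linear_iff inner_add_left algebra_simps sum.distrib scaleR_sum_right)
  show "norm (?U x) = norm x" for x
    by (rule norm_eq_coordinates) (simp add: reindex[of "\<lambda>b. (x \<bullet> b)\<^sup>2"])
  have [measurable]: "?U \<in> borel_measurable borel"
    by (intro borel_measurable_continuous_onI continuous_intros)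
  show "distr lborel borel ?U = lborel"
  proof (rule lborel_eqI[symmetric])
    fix l u :: 'a assume le: "\<And>b. b \<in> Basis \<Longrightarrow> l \<bullet> b \<le> u \<bullet> b"
    define q where "q = inv_into Basis p"
    have q: "q c \<in> Basis" "p (q c) = c" if "c \<in> Basis" for c
      using p that by (auto simp: q_def bij_betw_def f_inv_into_f inv_into_into)
    have qp: "q (p b) = b" if "b \<in> Basis" for b
      using p that by (simp add: q_def bij_betw_inv_into_left)
    have pB: "p b \<in> Basis" if "b \<in> Basis" for b using p that by (auto simp: bij_betw_def)
    \<comment> \<open>\<open>W\<close> permutes by the inverse \<open>q\<close> of \<open>p\<close>,
      so it carries the corners of a box to the corners of its preimage.\<close>
    define W where "W = (\<lambda>v::'a. \<Sum>c\<in>Basis. (v \<bullet> q c) *\<^sub>R c)"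
    have W: "W v \<bullet> c = v \<bullet> q c" if "c \<in> Basis" for v c using that by (simp add: W_def)
    have box: "?U -` box l u = box (W l) (W u)"
      unfolding box_def using q qp pB by (auto simp: W) metis+
    have "emeasure (distr lborel borel ?U) (box l u) = emeasure lborel (box (W l) (W u))"
      by (subst emeasure_distr) (auto simp: box)
    also have "\<dots> = (\<Prod>c\<in>Basis. (W u - W l) \<bullet> c)"
      using le q by (intro emeasure_lborel_box) (simp add: W)
    also have "(\<Prod>c\<in>Basis. (W u - W l) \<bullet> c) = (\<Prod>b\<in>Basis. (W u - W l) \<bullet> p b)"
      using p by (rule prod.reindex_bij_betw[symmetric])
    also have "\<dots> = (\<Prod>b\<in>Basis. (u - l) \<bullet> b)"
      using pB by (intro prod.cong) (auto simp: W qp inner_diff_left)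
    finally show "emeasure (distr lborel borel ?U) (box l u) = (\<Prod>b\<in>Basis. (u - l) \<bullet> b)" .
  qed simp
qed

section \<open>Integrals and second moments of a uniform direction\<close>

interpretation US: prob_space "uniform_sphere :: 'a::euclidean_space measure"
  by (rule prob_space_uniform_sphere)

text \<open>A continuous function is bounded on the compact sphere, which carries all the
  mass.\<close>

lemma integrable_uniform_sphere:
  fixes g :: "'a::euclidean_space \<Rightarrow> real"
  assumes g: "continuous_on UNIV g"
  shows "integrable uniform_sphere g"
proof -
  obtain B where B: "\<And>x. x \<in> sphere 0 1 \<Longrightarrow> norm (g x) \<le> B"
    using compact_continuous_image[OF continuous_on_subset[OF g subset_UNIV] compact_sphere[of 0 1],
        THEN compact_imp_bounded]
    unfolding bounded_iff by blast
  have [measurable]: "g \<in> borel_measurable borel"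
    using g by (rule borel_measurable_continuous_onI)
  have "AE x in uniform_sphere. norm (g x) \<le> B"
    using AE_uniform_sphere by eventually_elim (rule B)
  then show ?thesis by (rule US.integrable_const_bound) measurable
qed

lemma integral_uniform_sphere_invariant:
  fixes g :: "'a::euclidean_space \<Rightarrow> real" and U :: "'a \<Rightarrow> 'a"
  assumes "distr uniform_sphere borel U = uniform_sphere"
    and "U \<in> borel_measurable borel" and "g \<in> borel_measurable borel"
  shows "(\<integral>x. g (U x) \<partial>uniform_sphere) = (\<integral>x. g x \<partial>uniform_sphere)"
  using integral_distr[of U "uniform_sphere :: 'a measure" borel g] assms by simp

lemma integral_uniform_sphere_uminus:
  fixes g :: "'a::euclidean_space \<Rightarrow> real"
  assumes "g \<in> borel_measurable borel"
  shows "(\<integral>x. g (- x) \<partial>uniform_sphere) = (\<integral>x. g x \<partial>uniform_sphere)"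
  by (rule integral_uniform_sphere_invariant[OF distr_uniform_sphere_uminus _ assms]) simp

text \<open>The pairing of \<open>x\<close> with \<open>- x\<close>: it kills odd functions, gives
  the lower bound on the mean norm, and in dimension one makes the integrand constant almost
  everywhere.\<close>

lemma integral_uniform_sphere_symmetrize:
  fixes g :: "'a::euclidean_space \<Rightarrow> real"
  assumes g: "continuous_on UNIV g"
  shows "(\<integral>x. g x \<partial>uniform_sphere) = (\<integral>x. (g x + g (- x)) / 2 \<partial>uniform_sphere)"
proof -
  have "integrable uniform_sphere (\<lambda>x. g (- x))"
    by (intro integrable_uniform_sphere continuous_on_compose2[OF g]) (auto intro!: continuous_intros)
  then show ?thesis
    using integral_uniform_sphere_uminus[OF borel_measurable_continuous_onI[OF g]]
      integrable_uniform_sphere[OF g] by simp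
qed

lemma integral_uniform_sphere_inner:
  "(\<integral>x. x \<bullet> w \<partial>uniform_sphere) = (0::real)" for w :: "'a::euclidean_space"
  by (subst integral_uniform_sphere_symmetrize) (auto intro!: continuous_intros)

lemma integral_uniform_sphere_coordinates:
  fixes b c :: "'a::euclidean_space"
  assumes b: "b \<in> Basis" and c: "c \<in> Basis" and "b \<noteq> c"
  shows "(\<integral>x. (x \<bullet> b) * (x \<bullet> c) \<partial>uniform_sphere) = 0"
proof -
  \<comment> \<open>Flipping the sign of the single coordinate \<open>b\<close> preserves the law
    and negates the integrand.\<close>
  let ?U = "\<lambda>x::'a. \<Sum>d\<in>Basis. ((if d = b then -1 else 1) * (x \<bullet> d)) *\<^sub>R d"
  have [measurable]: "?U \<in> borel_measurable borel"
    by (intro borel_measurable_continuous_onI continuous_intros)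
  have "(\<integral>x. (x \<bullet> b) * (x \<bullet> c) \<partial>uniform_sphere) = (\<integral>x. (?U x \<bullet> b) * (?U x \<bullet> c) \<partial>uniform_sphere)"
    by (rule integral_uniform_sphere_invariant[OF distr_uniform_sphere_flip, symmetric]) auto
  also have "\<dots> = (\<integral>x. - ((x \<bullet> b) * (x \<bullet> c)) \<partial>uniform_sphere)"
    using assms by simp
  finally show ?thesis by simp
qed

text \<open>There is a second coordinate \<open>c\<close>. Swapping \<open>b\<close> and
  \<open>c\<close> shows that both have the same second moment, and the two squares add up to at
  most \<open>norm x ^ 2 = 1\<close>.\<close>

lemma integral_uniform_sphere_coordinate_le:
  fixes b :: "'a::euclidean_space"
  assumes dim: "2 \<le> DIM('a)" and b: "b \<in> Basis"
  shows "(\<integral>x. (x \<bullet> b)\<^sup>2 \<partial>uniform_sphere) \<le> 1 / 2"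
proof -
  have "Basis \<noteq> {b}"
  proof
    assume "Basis = {b}"
    then have "DIM('a) = card {b}" by (rule arg_cong)
    with dim show False by simp
  qed
  then obtain c where c: "c \<in> Basis" "c \<noteq> b" using b by auto
  define p where "p = (\<lambda>d. if d = b then c else if d = c then b else d)"
  have "bij_betw p Basis Basis"
    by (rule bij_betwI[where g=p]) (use b c in \<open>auto simp: p_def\<close>)
  note inv = distr_uniform_sphere_permute[OF this]
  let ?U = "\<lambda>x::'a. \<Sum>d\<in>Basis. (x \<bullet> p d) *\<^sub>R d"
  have [measurable]: "?U \<in> borel_measurable borel"
    by (intro borel_measurable_continuous_onI continuous_intros)
  have "(\<integral>x. (x \<bullet> b)\<^sup>2 \<partial>uniform_sphere) = (\<integral>x. (?U x \<bullet> b)\<^sup>2 \<partial>uniform_sphere)"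
    by (rule integral_uniform_sphere_invariant[OF inv, symmetric]) auto
  also have "\<dots> = (\<integral>x. (x \<bullet> c)\<^sup>2 \<partial>uniform_sphere)"
    using b by (simp add: p_def)
  finally have "2 * (\<integral>x. (x \<bullet> b)\<^sup>2 \<partial>uniform_sphere)
      = (\<integral>x. (x \<bullet> b)\<^sup>2 + (x \<bullet> c)\<^sup>2 \<partial>uniform_sphere)"
    by (subst Bochner_Integration.integral_add)
       (auto intro!: integrable_uniform_sphere continuous_intros)
  also have "\<dots> \<le> (\<integral>x. 1 \<partial>(uniform_sphere :: 'a measure))"
  proof (intro integral_mono_AE integrable_uniform_sphere continuous_intros)
    show "AE x in uniform_sphere. (x \<bullet> b)\<^sup>2 + (x \<bullet> c)\<^sup>2 \<le> 1"
      using AE_uniform_sphere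
    proof eventually_elim
      case (elim x)
      have "(\<Sum>d\<in>{b, c}. (x \<bullet> d)\<^sup>2) \<le> (\<Sum>d\<in>Basis. (x \<bullet> d)\<^sup>2)"
        using b c by (intro sum_mono2) auto
      also have "\<dots> = x \<bullet> x" by (subst euclidean_inner) (simp add: power2_eq_square)
      also have "\<dots> = 1" using elim by (simp add: dot_square_norm)
      finally show ?case using c by simp
    qed
  qed
  finally show ?thesis by (simp add: US.prob_space)
qed

lemma integral_uniform_sphere_inner_square_le:
  fixes w :: "'a::euclidean_space"
  assumes dim: "2 \<le> DIM('a)"
  shows "(\<integral>x. (w \<bullet> x)\<^sup>2 \<partial>uniform_sphere) \<le> (norm w)\<^sup>2 / 2"
proof -
  have int: "integrable uniform_sphere (\<lambda>x::'a. (x \<bullet> b) * (x \<bullet> c))" for b c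
    by (intro integrable_uniform_sphere continuous_intros)
  have "(w \<bullet> x)\<^sup>2 = (\<Sum>b\<in>Basis. \<Sum>c\<in>Basis. (w \<bullet> b) * (w \<bullet> c) * ((x \<bullet> b) * (x \<bullet> c)))" for x
    by (subst euclidean_inner) (simp add: power2_eq_square sum_product algebra_simps)
  then have "(\<integral>x. (w \<bullet> x)\<^sup>2 \<partial>uniform_sphere)
    = (\<Sum>b\<in>Basis. \<Sum>c\<in>Basis. (w \<bullet> b) * (w \<bullet> c) * (\<integral>x. (x \<bullet> b) * (x \<bullet> c) \<partial>uniform_sphere))"
    using int by simp
  also have "\<dots> = (\<Sum>b\<in>Basis. \<Sum>c\<in>Basis.
      if c = b then (w \<bullet> b)\<^sup>2 * (\<integral>x. (x \<bullet> b)\<^sup>2 \<partial>uniform_sphere) else 0)"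
    by (intro sum.cong refl) (auto simp: integral_uniform_sphere_coordinates power2_eq_square)
  also have "\<dots> = (\<Sum>b\<in>Basis. (w \<bullet> b)\<^sup>2 * (\<integral>x. (x \<bullet> b)\<^sup>2 \<partial>uniform_sphere))"
    by simp
  also have "\<dots> \<le> (\<Sum>b\<in>Basis. (w \<bullet> b)\<^sup>2 * (1 / 2))"
    by (intro sum_mono mult_left_mono integral_uniform_sphere_coordinate_le dim) auto
  also have "\<dots> = (norm w)\<^sup>2 / 2"
    unfolding power2_norm_eq_inner
    by (subst (2) euclidean_inner) (simp add: power2_eq_square sum_divide_distrib)
  finally show ?thesis .
qed

section \<open>Dimension at least two\<close>

text \<open>The gradient of \<open>sqrt (norm v ^ 2 + 1)\<close>, as a map of its own so that its
  continuity and bound can be stated once.\<close>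

definition soft_normalize :: "'a::euclidean_space \<Rightarrow> 'a" where
  "soft_normalize v = v /\<^sub>R sqrt ((norm v)\<^sup>2 + 1)"

lemma continuous_on_soft_normalize [continuous_intros]:
  assumes "continuous_on S f"
  shows "continuous_on S (\<lambda>x. soft_normalize (f x))"
proof -
  have "sqrt ((norm (f x))\<^sup>2 + 1) \<noteq> 0" for x
    by (simp add: add_nonneg_eq_0_iff)
  then show ?thesis
    unfolding soft_normalize_def by (intro continuous_intros assms) auto
qed

lemma norm_soft_normalize_le: "norm (soft_normalize v) \<le> 1"
proof -
  have "norm v \<le> sqrt ((norm v)\<^sup>2 + 1)"
    by (rule real_le_rsqrt) simp
  moreover have "0 < sqrt ((norm v)\<^sup>2 + 1)"
    using zero_le_power2[of "norm v"] by (simp add: add_nonneg_pos)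
  ultimately show ?thesis
    by (simp add: soft_normalize_def divide_inverse[symmetric] field_simps)
qed

text \<open>With \<open>r = sqrt (norm v ^ 2 + 1)\<close> and \<open>s = v \<bullet> x\<close>, the
  loss is \<open>s / r\<close>, and
  \<open>norm (v - x) ^ 2 \<le> r ^ 2 - 2 * s \<le> (r - s / r) ^ 2\<close>. The added 1 under the
  root pays for \<open>norm x ^ 2\<close>.\<close>

lemma soft_normalize_inner_le:
  fixes v x :: "'a::euclidean_space"
  assumes "norm x \<le> 1"
  shows "soft_normalize v \<bullet> x + norm (v - x) \<le> sqrt ((norm v)\<^sup>2 + 1)"
proof -
  define r where "r = sqrt ((norm v)\<^sup>2 + 1)"
  define s where "s = v \<bullet> x"
  have r2: "r\<^sup>2 = (norm v)\<^sup>2 + 1" and r1: "1 \<le> r" by (simp_all add: r_def)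
  have "norm v \<le> r" unfolding r_def by (rule real_le_rsqrt) simp
  have "s \<le> norm v * norm x" unfolding s_def by (rule norm_cauchy_schwarz)
  also have "\<dots> \<le> r * 1" using \<open>norm v \<le> r\<close> r1 assms by (intro mult_mono) auto
  also have "\<dots> \<le> r * r" using r1 by (intro mult_left_mono) auto
  finally have "0 \<le> r - s / r" using r1 by (simp add: field_simps)
  moreover have "(norm (v - x))\<^sup>2 \<le> (r - s / r)\<^sup>2"
  proof -
    have "(norm x)\<^sup>2 \<le> 1" using assms by (simp add: power_le_one)
    moreover have "(norm (v - x))\<^sup>2 = (norm v)\<^sup>2 - 2 * s + (norm x)\<^sup>2"
      by (simp add: power2_norm_eq_inner s_def inner_diff_left inner_diff_right inner_commute)
    moreover have "(r - s / r)\<^sup>2 = r\<^sup>2 - 2 * s + (s / r)\<^sup>2"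
      using r1 by (simp add: power2_diff)
    moreover have "0 \<le> (s / r)\<^sup>2" by simp
    ultimately show ?thesis using r2 by linarith
  qed
  ultimately have "norm (v - x) \<le> r - s / r" by (rule power2_le_imp_le[rotated])
  moreover have "soft_normalize v \<bullet> x = s / r"
    by (simp add: soft_normalize_def r_def s_def divide_inverse mult.commute)
  ultimately show ?thesis by (simp add: r_def)
qed

text \<open>\<open>q\<close> is the squared cosine of the angle between \<open>w\<close> and
  \<open>x\<close>, and 0 for \<open>w = 0\<close>. The bound interpolates between the orthogonal
  case \<open>q = 0\<close>, where it is an equality, and the parallel case \<open>q = 1\<close>. It
  is affine in \<open>q\<close>, so averaging it requires only the mean of \<open>q\<close>.\<close>

lemma norm_symmetrize_ge:
  fixes w x :: "'a::euclidean_space"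
  assumes x: "norm x = 1"
  defines "q \<equiv> (w \<bullet> x)\<^sup>2 / (norm w)\<^sup>2"
  shows "(1 - q) * sqrt ((norm w)\<^sup>2 + C\<^sup>2) + q * norm w
    \<le> (norm (w + C *\<^sub>R x) + norm (w - C *\<^sub>R x)) / 2"
proof -
  define r where "r = norm w"
  define a where "a = sqrt (r\<^sup>2 + C\<^sup>2)"
  have a2: "a\<^sup>2 = r\<^sup>2 + C\<^sup>2" by (simp add: a_def)
  have "(w \<bullet> x)\<^sup>2 \<le> r\<^sup>2"
    using Cauchy_Schwarz_ineq2[of w x] x abs_le_square_iff[of "w \<bullet> x" r] by (simp add: r_def)
  then have q: "0 \<le> q" "q \<le> 1" "q * r\<^sup>2 = (w \<bullet> x)\<^sup>2"
    by (auto simp: q_def r_def divide_le_eq_1)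
  define Y Z where "Y = norm (w + C *\<^sub>R x)" and "Z = norm (w - C *\<^sub>R x)"
  have xx: "x \<bullet> x = 1" using x by (simp add: dot_square_norm)
  have Y2: "Y\<^sup>2 = a\<^sup>2 + 2 * C * (w \<bullet> x)"
    unfolding Y_def a2 r_def power2_norm_eq_inner
    by (simp add: inner_add_left inner_add_right inner_commute xx power2_eq_square)
  have Z2: "Z\<^sup>2 = a\<^sup>2 - 2 * C * (w \<bullet> x)"
    unfolding Z_def a2 r_def power2_norm_eq_inner
    by (simp add: inner_diff_left inner_diff_right inner_commute xx power2_eq_square)
  have "(Y * Z)\<^sup>2 = a\<^sup>2 * a\<^sup>2 - 4 * C\<^sup>2 * (q * r\<^sup>2)"
    unfolding power_mult_distrib Y2 Z2 q(3) by (simp add: power2_eq_square algebra_simps)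
  moreover have "(a\<^sup>2 - 2 * q * C\<^sup>2)\<^sup>2
      = a\<^sup>2 * a\<^sup>2 - 4 * C\<^sup>2 * (q * r\<^sup>2) - 4 * C\<^sup>2 * C\<^sup>2 * (q * (1 - q))"
    unfolding a2 by (simp add: power2_eq_square algebra_simps)
  moreover have "0 \<le> 4 * C\<^sup>2 * C\<^sup>2 * (q * (1 - q))"
    using q by simp
  ultimately have "(a\<^sup>2 - 2 * q * C\<^sup>2)\<^sup>2 \<le> (Y * Z)\<^sup>2" by linarith
  \<comment> \<open>The left-hand side may be negative; comparing squares only requires
    \<open>Y * Z\<close> to be nonnegative.\<close>
  then have YZ: "a\<^sup>2 - 2 * q * C\<^sup>2 \<le> Y * Z"
    by (rule power2_le_imp_le) (simp add: Y_def Z_def)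
  \<comment> \<open>The square of a weighted mean is at most the weighted mean
    \<open>a ^ 2 - q * C ^ 2\<close> of the squares, which \<open>YZ\<close> bounds by the square of
    \<open>(Y + Z) / 2\<close>.\<close>
  have "((1 - q) * a + q * r)\<^sup>2 = (1 - q) * a\<^sup>2 + q * r\<^sup>2 - q * (1 - q) * (a - r)\<^sup>2"
    by (simp add: power2_eq_square algebra_simps)
  also have "\<dots> \<le> (1 - q) * a\<^sup>2 + q * r\<^sup>2"
    using q by simp
  also have "\<dots> = a\<^sup>2 - q * C\<^sup>2"
    unfolding a2 by (simp add: algebra_simps)
  also have "\<dots> \<le> ((Y + Z) / 2)\<^sup>2"
    using YZ Y2 Z2 by (simp add: power2_sum power_divide)
  finally have "(1 - q) * a + q * r \<le> (Y + Z) / 2"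
    by (rule power2_le_imp_le) (simp add: Y_def Z_def)
  then show ?thesis by (simp add: Y_def Z_def a_def r_def)
qed

text \<open>
  The averaged fraction \<open>q\<close> of \<open>norm_symmetrize_ge\<close> is at most \<open>1 / 2\<close> only from dimension two on; in
  dimension one the bound below is false for every \<open>w\<close> with \<open>norm w \<ge> C\<close>.
\<close>

lemma integral_norm_uniform_sphere_ge:
  fixes w :: "'a::euclidean_space"
  assumes dim: "2 \<le> DIM('a)" and C: "4 \<le> C\<^sup>2"
  shows "sqrt ((norm w)\<^sup>2 + 1) \<le> (\<integral>x. norm (w + C *\<^sub>R x) \<partial>uniform_sphere)"
proof -
  define r a where "r = norm w" and "a = sqrt (r\<^sup>2 + C\<^sup>2)"
  define q where "q x = (w \<bullet> x)\<^sup>2 / (norm w)\<^sup>2" for x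
  have "r \<le> a" unfolding a_def by (rule real_le_rsqrt) simp
  have q: "integrable uniform_sphere q"
    unfolding q_def divide_inverse by (intro integrable_uniform_sphere continuous_intros)
  have "(\<integral>x. q x \<partial>uniform_sphere) = (\<integral>x. (w \<bullet> x)\<^sup>2 \<partial>uniform_sphere) / (norm w)\<^sup>2"
    by (simp add: q_def)
  also have "\<dots> \<le> ((norm w)\<^sup>2 / 2) / (norm w)\<^sup>2"
    by (intro divide_right_mono integral_uniform_sphere_inner_square_le dim) simp
  also have "\<dots> \<le> 1 / 2" by simp
  finally have half: "(\<integral>x. q x \<partial>uniform_sphere) \<le> 1 / 2" .
  \<comment> \<open>This fixes the requirement on \<open>C\<close>: since \<open>r \<le> a\<close>,
    the square is at least \<open>4 * r ^ 2 + C ^ 2\<close>.\<close>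
  have "4 * r\<^sup>2 + 4 \<le> (a + r)\<^sup>2"
  proof -
    have "r * r \<le> a * r" using \<open>r \<le> a\<close> by (intro mult_right_mono) (auto simp: r_def)
    moreover have "a\<^sup>2 = r\<^sup>2 + C\<^sup>2" by (simp add: a_def)
    ultimately show ?thesis using C by (simp add: power2_sum) (simp add: power2_eq_square)
  qed
  then have "sqrt (r\<^sup>2 + 1) \<le> (a + r) / 2"
    using \<open>r \<le> a\<close> order_trans[OF norm_ge_zero[of w] \<open>r \<le> a\<close>[unfolded r_def]]
    by (intro real_le_lsqrt) (auto simp: r_def power_divide)
  also have "\<dots> = a - (a - r) * (1 / 2)" by (simp add: field_simps)
  also have "\<dots> \<le> a - (a - r) * (\<integral>x. q x \<partial>uniform_sphere)"
    using half \<open>r \<le> a\<close> by (intro diff_left_mono mult_left_mono) auto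
  also have "\<dots> = (\<integral>x. a - (a - r) * q x \<partial>uniform_sphere)"
    using q by (simp add: US.prob_space)
  also have "\<dots> \<le> (\<integral>x. (norm (w + C *\<^sub>R x) + norm (w + C *\<^sub>R (- x))) / 2 \<partial>uniform_sphere)"
  proof (rule integral_mono_AE)
    show "AE x in uniform_sphere.
        a - (a - r) * q x \<le> (norm (w + C *\<^sub>R x) + norm (w + C *\<^sub>R (- x))) / 2"
      using AE_uniform_sphere
    proof eventually_elim
      case (elim x)
      with norm_symmetrize_ge[of x w C] show ?case
        by (simp add: a_def r_def q_def algebra_simps)
    qed
  qed (use q in \<open>auto intro!: integrable_uniform_sphere continuous_intros\<close>)
  also have "\<dots> = (\<integral>x. norm (w + C *\<^sub>R x) \<partial>uniform_sphere)"
    by (rule integral_uniform_sphere_symmetrize[symmetric]) (intro continuous_intros)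
  finally show ?thesis by (simp add: r_def)
qed

section \<open>Expectations over sums of independent uniform directions\<close>

definition walk :: "'i set \<Rightarrow> ('a::euclidean_space \<Rightarrow> real) \<Rightarrow> real" where
  "walk I g = (\<integral>z. g (\<Sum>i\<in>I. z i) \<partial>PiM I (\<lambda>_. uniform_sphere))"

interpretation PUS: product_prob_space "\<lambda>_. uniform_sphere :: 'a::euclidean_space measure" I for I
  by unfold_locales

text \<open>Almost surely the sum lies in the ball of radius \<open>card I\<close>, and
  \<open>g\<close> is bounded there.\<close>

lemma integrable_walk:
  fixes g :: "'a::euclidean_space \<Rightarrow> real" and I :: "'i set"
  assumes I: "finite I" and g: "continuous_on UNIV g"
  shows "integrable (PiM I (\<lambda>_. uniform_sphere)) (\<lambda>z. g (\<Sum>i\<in>I. z i))"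
proof -
  obtain B where B: "\<And>x. x \<in> cball 0 (card I) \<Longrightarrow> norm (g x) \<le> B"
    using compact_continuous_image[OF continuous_on_subset[OF g subset_UNIV] compact_cball[of 0 "card I"],
        THEN compact_imp_bounded]
    unfolding bounded_iff by blast
  have [measurable]: "g \<in> borel_measurable borel"
    using g by (rule borel_measurable_continuous_onI)
  have "AE z in PiM I (\<lambda>_. uniform_sphere :: 'a measure). \<forall>i\<in>I. z i \<in> sphere 0 1"
    using I by (intro eventually_ball_finite ballI AE_PiM_component
        prob_space_uniform_sphere AE_uniform_sphere)
  then have "AE z in PiM I (\<lambda>_. uniform_sphere :: 'a measure). norm (g (\<Sum>i\<in>I. z i)) \<le> B"
  proof eventually_elim
    case (elim z)
    have "norm (\<Sum>i\<in>I. z i) \<le> card I"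
      using norm_sum[of z I] elim by simp
    then show ?case by (intro B) simp
  qed
  then show ?thesis
    by (rule PUS.integrable_const_bound) measurable
qed

lemma walk_empty [simp]: "walk {} g = g (0::'a::euclidean_space)"
  by (simp add: walk_def prob_space.prob_space[OF prob_space_PiM[OF prob_space_uniform_sphere]])

text \<open>Fubini for one draw. Indexing by a set suits the game: in each round one index leaves
  the set \<open>{t<..T}\<close> of remaining draws.\<close>

lemma walk_insert:
  fixes g :: "'a::euclidean_space \<Rightarrow> real"
  assumes I: "finite I" "i \<notin> I" and g: "continuous_on UNIV g"
  shows "walk (insert i I) g = walk I (\<lambda>s. \<integral>y. g (s + y) \<partial>uniform_sphere)"
proof -
  have "(\<Sum>j\<in>insert i I. (z(i := y)) j) = (\<Sum>j\<in>I. z j) + y" for z :: "_ \<Rightarrow> 'a" and y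
  proof -
    have "(\<Sum>j\<in>I. (z(i := y)) j) = (\<Sum>j\<in>I. z j)"
      using I by (intro sum.cong) auto
    then show ?thesis using I by (simp add: add.commute)
  qed
  note sum = this
  show ?thesis
    unfolding walk_def using I
    by (subst PUS.product_integral_insert[OF I integrable_walk[OF _ g]]) (simp_all only: sum finite_insert)
qed

lemma walk_mono:
  assumes "finite I" "continuous_on UNIV g" "continuous_on UNIV h" "\<And>s. g s \<le> h s"
  shows "walk I g \<le> walk I h"
  unfolding walk_def using assms by (intro integral_mono integrable_walk) auto

lemma walk_add:
  assumes "finite I" "continuous_on UNIV g" "continuous_on UNIV h"
  shows "walk I (\<lambda>s. g s + h s) = walk I g + walk I h"
  unfolding walk_def using assms by (intro Bochner_Integration.integral_add integrable_walk)

lemma walk_const: "walk I (\<lambda>s::'a::euclidean_space. c) = c"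
  by (simp add: walk_def prob_space.prob_space[OF prob_space_PiM[OF prob_space_uniform_sphere]])

lemma walk_cmult: "walk I (\<lambda>s. c * g s) = c * walk I g"
  by (simp add: walk_def)

text \<open>One round of the potential argument. For fixed \<open>z\<close>, put
  \<open>v = - s + C *\<^sub>R z\<close>: loss plus new norm is at most
  \<open>sqrt (norm v ^ 2 + 1)\<close>, which is at most the mean of
  \<open>norm (v + C *\<^sub>R y)\<close> over the extra draw \<open>y\<close>.\<close>

lemma walk_step_high_dim:
  fixes x s :: "'a::euclidean_space"
  assumes dim: "2 \<le> DIM('a)" and C: "4 \<le> C\<^sup>2" and x: "norm x \<le> 1"
    and I: "finite I" "i \<notin> I"
  shows "walk I (\<lambda>z. soft_normalize (- s + C *\<^sub>R z) \<bullet> x) + walk I (\<lambda>z. norm (- (s + x) + C *\<^sub>R z))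
    \<le> walk (insert i I) (\<lambda>z. norm (- s + C *\<^sub>R z))"
proof -
  define h where "h z = (\<integral>y. norm (- s + C *\<^sub>R (z + y)) \<partial>uniform_sphere)" for z
  \<comment> \<open>Monotonicity of \<open>walk\<close> is stated for continuous functions; the
    parameter integral \<open>h\<close> inherits a Lipschitz bound from the norm.\<close>
  have "\<bar>C\<bar>-lipschitz_on UNIV h"
  proof (rule lipschitz_onI)
    fix z z' :: 'a
    have "\<bar>h z - h z'\<bar>
        = \<bar>\<integral>y. norm (- s + C *\<^sub>R (z + y)) - norm (- s + C *\<^sub>R (z' + y)) \<partial>uniform_sphere\<bar>"
      unfolding h_def
      by (subst Bochner_Integration.integral_diff)
         (auto intro!: integrable_uniform_sphere continuous_intros)
    also have "\<dots> \<le> (\<integral>y. \<bar>norm (- s + C *\<^sub>R (z + y)) - norm (- s + C *\<^sub>R (z' + y))\<bar> \<partial>uniform_sphere)"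
      by (rule integral_abs_bound)
    also have "\<dots> \<le> (\<integral>y. \<bar>C\<bar> * dist z z' \<partial>(uniform_sphere :: 'a measure))"
    proof (intro integral_mono)
      fix y
      have "\<bar>norm (- s + C *\<^sub>R (z + y)) - norm (- s + C *\<^sub>R (z' + y))\<bar>
          \<le> norm ((- s + C *\<^sub>R (z + y)) - (- s + C *\<^sub>R (z' + y)))"
        by (rule norm_triangle_ineq3)
      also have "(- s + C *\<^sub>R (z + y)) - (- s + C *\<^sub>R (z' + y)) = C *\<^sub>R (z - z')"
        by (simp add: algebra_simps)
      finally show "\<bar>norm (- s + C *\<^sub>R (z + y)) - norm (- s + C *\<^sub>R (z' + y))\<bar> \<le> \<bar>C\<bar> * dist z z'"
        by (simp add: dist_norm)
    qed (auto intro!: integrable_uniform_sphere continuous_intros)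
    finally show "dist (h z) (h z') \<le> \<bar>C\<bar> * dist z z'"
      by (simp add: dist_real_def US.prob_space)
  qed simp
  then have h: "continuous_on UNIV h"
    by (rule lipschitz_on_continuous_on)
  have "walk I (\<lambda>z. soft_normalize (- s + C *\<^sub>R z) \<bullet> x) + walk I (\<lambda>z. norm (- (s + x) + C *\<^sub>R z))
      = walk I (\<lambda>z. soft_normalize (- s + C *\<^sub>R z) \<bullet> x + norm (- (s + x) + C *\<^sub>R z))"
    by (intro walk_add[symmetric] I continuous_intros)
  also have "\<dots> \<le> walk I h"
  proof (intro walk_mono I h continuous_intros)
    fix z
    have "soft_normalize (- s + C *\<^sub>R z) \<bullet> x + norm ((- s + C *\<^sub>R z) - x)
        \<le> sqrt ((norm (- s + C *\<^sub>R z))\<^sup>2 + 1)"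
      by (rule soft_normalize_inner_le[OF x])
    also have "\<dots> \<le> (\<integral>y. norm ((- s + C *\<^sub>R z) + C *\<^sub>R y) \<partial>uniform_sphere)"
      by (rule integral_norm_uniform_sphere_ge[OF dim C])
    finally show "soft_normalize (- s + C *\<^sub>R z) \<bullet> x + norm (- (s + x) + C *\<^sub>R z) \<le> h z"
      by (simp add: h_def algebra_simps)
  qed
  also have "\<dots> = walk (insert i I) (\<lambda>z. norm (- s + C *\<^sub>R z))"
    unfolding h_def by (intro walk_insert[symmetric] I continuous_intros)
  finally show ?thesis .
qed

lemma path_regret_high_dim:
  fixes x :: "nat \<Rightarrow> 'a::euclidean_space"
  assumes dim: "2 \<le> DIM('a)" and C: "4 \<le> C\<^sup>2" "0 \<le> C"
    and x: "\<And>t. t \<in> {1..T} \<Longrightarrow> norm (x t) \<le> 1"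
  shows "(\<Sum>t\<in>{1..T}. walk {t<..T} (\<lambda>z. soft_normalize (- (\<Sum>i\<in>{1..<t}. x i) + C *\<^sub>R z) \<bullet> x t))
      + norm (\<Sum>t\<in>{1..T}. x t) \<le> C * walk {1..T} (norm :: 'a \<Rightarrow> real)"
proof -
  let ?F = "\<lambda>t. walk {t<..T} (\<lambda>z. soft_normalize (- (\<Sum>i\<in>{1..<t}. x i) + C *\<^sub>R z) \<bullet> x t)"
  \<comment> \<open>The potential after round \<open>t\<close>. At \<open>t = T\<close> no draw
    remains and it is the norm of the sum of the moves; at \<open>t = 0\<close> no move has been
    made and it is the claimed bound.\<close>
  let ?U = "\<lambda>t. walk {t<..T} (\<lambda>z. norm (- (\<Sum>i\<in>{1..t}. x i) + C *\<^sub>R z))"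
  have "(\<Sum>t\<in>{1..m}. ?F t) + ?U m \<le> ?U 0" if "m \<le> T" for m
    using that
  proof (induction m)
    case (Suc m)
    have "{m<..T} = insert (Suc m) {Suc m<..T}" using Suc.prems by auto
    with walk_step_high_dim[OF dim C(1) x, of "Suc m" "{Suc m<..T}" "Suc m" "\<Sum>i\<in>{1..m}. x i"] Suc.prems
    have "?F (Suc m) + ?U (Suc m) \<le> ?U m"
      by (simp add: atLeastLessThanSuc_atLeastAtMost)
    with Suc show ?case by simp
  qed simp
  from this[of T] have "(\<Sum>t\<in>{1..T}. ?F t) + norm (\<Sum>t\<in>{1..T}. x t) \<le> ?U 0"
    by simp
  also have "?U 0 = C * walk {1..T} (norm :: 'a \<Rightarrow> real)"
    using C by (simp add: walk_cmult atLeastSucAtMost_greaterThanAtMost[symmetric])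
  finally show ?thesis .
qed

text \<open>Each draw adds its squared length 1, because the cross term has mean zero.\<close>

lemma walk_norm_square:
  assumes "finite I"
  shows "walk I (\<lambda>s::'a::euclidean_space. (norm s)\<^sup>2) = card I"
  using assms
proof (induction I)
  case (insert i I)
  have "(\<integral>y. (norm (s + y))\<^sup>2 \<partial>uniform_sphere) = (norm s)\<^sup>2 + 1" for s :: 'a
  proof -
    have "(\<integral>y. (norm (s + y))\<^sup>2 \<partial>uniform_sphere)
        = (\<integral>y. (norm s)\<^sup>2 + 1 + 2 * (y \<bullet> s) \<partial>uniform_sphere)"
    proof (rule integral_cong_AE)
      show "AE y in uniform_sphere. (norm (s + y))\<^sup>2 = (norm s)\<^sup>2 + 1 + 2 * (y \<bullet> s)"
        using AE_uniform_sphere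
      proof eventually_elim
        case (elim y)
        then have "y \<bullet> y = 1" by (simp add: dot_square_norm)
        then show ?case
          by (simp add: power2_norm_eq_inner inner_add_left inner_add_right inner_commute)
      qed
    qed (auto intro!: borel_measurable_continuous_onI continuous_intros)
    also have "\<dots> = (norm s)\<^sup>2 + 1"
      by (subst Bochner_Integration.integral_add)
         (auto intro!: integrable_uniform_sphere continuous_intros
           simp: US.prob_space integral_uniform_sphere_inner)
    finally show ?thesis .
  qed
  then have "walk (insert i I) (\<lambda>s::'a. (norm s)\<^sup>2) = walk I (\<lambda>s::'a. (norm s)\<^sup>2 + 1)"
    using insert by (subst walk_insert) (auto intro!: continuous_intros)
  also have "\<dots> = walk I (\<lambda>s::'a. (norm s)\<^sup>2) + walk I (\<lambda>s::'a. 1)"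
    using insert by (intro walk_add continuous_intros)
  finally show ?case using insert by (simp add: walk_const)
qed simp

text \<open>The second moment controls the first through
  \<open>norm s \<le> norm s ^ 2 / (2 * a) + a / 2\<close>, with \<open>a\<close> the root of the
  second moment; this takes the place of Jensen's inequality.\<close>

lemma walk_norm_le:
  assumes I: "finite I"
  shows "walk I (norm :: 'a::euclidean_space \<Rightarrow> real) \<le> sqrt (card I)"
proof (cases "I = {}")
  case False
  define a where "a = sqrt (card I)"
  have a: "0 < a" "a\<^sup>2 = card I" using False I by (auto simp: a_def card_gt_0_iff)
  have "norm s \<le> 1 / (2 * a) * (norm s)\<^sup>2 + a / 2" for s :: 'a
  proof -
    have "0 \<le> (norm s - a)\<^sup>2 / (2 * a)" using a by simp
    also have "\<dots> = 1 / (2 * a) * (norm s)\<^sup>2 + a / 2 - norm s"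
      using a by (simp add: power2_eq_square field_simps)
    finally show ?thesis by simp
  qed
  then have "walk I (norm :: 'a \<Rightarrow> real) \<le> walk I (\<lambda>s::'a. 1 / (2 * a) * (norm s)\<^sup>2 + a / 2)"
    by (intro walk_mono I continuous_intros)
  also have "\<dots> = 1 / (2 * a) * a\<^sup>2 + a / 2"
    using I a(2)
    by (subst walk_add) (auto intro!: continuous_intros
        simp del: times_divide_eq_left simp: walk_cmult walk_norm_square walk_const)
  also have "\<dots> = a" using a(1) by (simp add: power2_eq_square field_simps)
  finally show ?thesis by (simp add: a_def)
qed simp

section \<open>Dimension one\<close>

text \<open>The mean of \<open>g\<close> over the sum of \<open>n\<close> fair signs,
  \<open>j\<close> of which are positive. The explicit binomial weights allow single atoms to be
  bounded.\<close>

definition coin_walk :: "nat \<Rightarrow> (real \<Rightarrow> real) \<Rightarrow> real" where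
  "coin_walk n g = (\<Sum>j\<le>n. real (n choose j) / 2 ^ n * g (2 * real j - real n))"

lemma coin_walk_0 [simp]: "coin_walk 0 g = g 0"
  by (simp add: coin_walk_def)

text \<open>Pascal's rule, which amounts to conditioning on one sign.\<close>

lemma coin_walk_Suc: "coin_walk (Suc n) g = coin_walk n (\<lambda>s. (g (s + 1) + g (s - 1)) / 2)"
proof -
  define h where "h j = g (2 * real j - real (Suc n))" for j
  have "(\<Sum>j\<le>Suc n. real (Suc n choose j) * h j)
      = h 0 + (\<Sum>j\<le>n. real ((n choose j) + (n choose Suc j)) * h (Suc j))"
    by (subst sum.atMost_Suc_shift) simp
  also have "\<dots> = (\<Sum>j\<le>n. real (n choose j) * h (Suc j))
      + (h 0 + (\<Sum>j\<le>n. real (n choose Suc j) * h (Suc j)))"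
    by (simp add: sum.distrib distrib_right)
  also have "h 0 + (\<Sum>j\<le>n. real (n choose Suc j) * h (Suc j)) = (\<Sum>j\<le>Suc n. real (n choose j) * h j)"
    by (subst sum.atMost_Suc_shift) simp
  also have "\<dots> = (\<Sum>j\<le>n. real (n choose j) * h j)"
    by simp
  finally have *: "(\<Sum>j\<le>Suc n. real (Suc n choose j) * h j)
      = (\<Sum>j\<le>n. real (n choose j) * (h (Suc j) + h j))"
    by (simp add: sum.distrib distrib_left)
  have "coin_walk (Suc n) g = (\<Sum>j\<le>Suc n. real (Suc n choose j) * h j) / 2 ^ Suc n"
    by (simp only: coin_walk_def h_def sum_divide_distrib) (simp add: mult.commute)
  also have "\<dots> = coin_walk n (\<lambda>s. (g (s + 1) + g (s - 1)) / 2)"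
    unfolding * unfolding coin_walk_def sum_divide_distrib h_def
    by (intro sum.cong refl) (simp add: field_simps)
  finally show ?thesis .
qed

lemma coin_walk_mono: "(\<And>s. g s \<le> h s) \<Longrightarrow> coin_walk n g \<le> coin_walk n h"
  unfolding coin_walk_def by (intro sum_mono mult_left_mono) auto

lemma coin_walk_add: "coin_walk n (\<lambda>s. g s + h s) = coin_walk n g + coin_walk n h"
  by (simp add: coin_walk_def sum.distrib distrib_left)

lemma coin_walk_cmult: "coin_walk n (\<lambda>s. c * g s) = c * coin_walk n g"
  by (simp add: coin_walk_def sum_distrib_left mult_ac)

lemma coin_walk_ge_single:
  assumes "\<And>s. 0 \<le> g s" "j \<le> n"
  shows "real (n choose j) / 2 ^ n * g (2 * real j - real n) \<le> coin_walk n g"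
  unfolding coin_walk_def using assms by (intro member_le_sum) auto

lemma coin_walk_nonneg: "(\<And>s. 0 \<le> g s) \<Longrightarrow> 0 \<le> coin_walk n g"
  unfolding coin_walk_def by (intro sum_nonneg mult_nonneg_nonneg) auto

section \<open>Binomial probabilities near the middle\<close>

definition central :: "nat \<Rightarrow> real" where
  "central n = real (n choose (n div 2)) / 2 ^ n"

lemma central_nonneg: "0 \<le> central n"
  by (simp add: central_def)

lemma binomial_le_central: "real (n choose j) / 2 ^ n \<le> central n"
  unfolding central_def by (intro divide_right_mono) (simp_all add: binomial_maximum)

text \<open>By Pascal's rule a coefficient of the next row is a sum of two coefficients of this row,
  each at most the middle one, while the denominator doubles.\<close>

lemma central_antimono:
  assumes "m \<le> n" shows "central n \<le> central m"
  using assms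
proof (rule lift_Suc_antimono_le[rotated])
  fix n
  have "Suc n choose (Suc n div 2) \<le> 2 * (n choose (n div 2))"
  proof (cases "Suc n div 2")
    case (Suc j)
    then show ?thesis
      using binomial_maximum[of n j] binomial_maximum[of n "Suc j"] by simp
  qed simp
  then have "real (Suc n choose (Suc n div 2)) \<le> 2 * real (n choose (n div 2))"
    by (metis of_nat_le_iff of_nat_mult of_nat_numeral)
  then show "central (Suc n) \<le> central n"
    by (simp add: central_def field_simps)
qed

text \<open>Moving from distance \<open>i\<close> to \<open>i + 1\<close> below the middle costs at
  most \<open>(2 * i + 2) / m\<close> of the middle coefficient, where \<open>m = n div 2\<close>.
  These costs add up to \<open>i * (i + 1) / m\<close>. The other side follows by reflection, with
  \<open>n mod 2\<close> accounting for the second middle index of an odd row.\<close>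

lemma binomial_near_central:
  assumes "n div 2 \<le> j + i" "j \<le> n div 2 + i + n mod 2" "i \<le> n div 2"
  shows "(1 - real i * (real i + 1) / real (n div 2)) * central n \<le> real (n choose j) / 2 ^ n"
proof -
  define m where "m = n div 2"
  have below: "(1 - real i * (real i + 1) / real m) * real (n choose m) \<le> real (n choose (m - i))"
    if "i \<le> m" for i
    using that
  proof (induction i)
    case (Suc i)
    define j where "j = m - Suc i"
    have j: "m - i = Suc j" "j < n" using Suc.prems by (auto simp: j_def m_def)
    have "Suc j * (n choose Suc j) = (n - j) * (n choose j)"
      by (metis Suc_times_binomial binomial_absorb_comp diff_Suc_1 j(2) less_imp_Suc_add)
    then have eq: "real (Suc j) * real (n choose Suc j) = real (n - j) * real (n choose j)"
      by (metis of_nat_mult)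
    have "n - j \<le> m + i + 2" using Suc.prems by (auto simp: j_def m_def)
    then have "real (Suc j) * real (n choose Suc j) \<le> real (m + i + 2) * real (n choose j)"
      unfolding eq by (intro mult_right_mono) auto
    then have "(1 - real (2 * i + 2) / real (m + i + 2)) * real (n choose Suc j) \<le> real (n choose j)"
      using Suc.prems j by (simp add: field_simps j_def of_nat_diff)
    moreover have "real (2 * i + 2) / real (m + i + 2) \<le> real (2 * i + 2) / real m"
      using Suc.prems by (intro divide_left_mono) auto
    then have "(1 - real (2 * i + 2) / real m) * real (n choose Suc j)
        \<le> (1 - real (2 * i + 2) / real (m + i + 2)) * real (n choose Suc j)"
      by (intro mult_right_mono) auto
    \<comment> \<open>Measuring every loss against the middle coefficient lets the losses add
      instead of multiply.\<close>
    moreover have "real (2 * i + 2) / real m * real (n choose Suc j)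
        \<le> real (2 * i + 2) / real m * real (n choose m)"
      by (intro mult_left_mono) (auto simp: m_def binomial_maximum)
    ultimately have "real (n choose Suc j) - real (2 * i + 2) / real m * real (n choose m)
        \<le> real (n choose j)"
      by (simp add: left_diff_distrib)
    moreover have "(1 - real i * (real i + 1) / real m) * real (n choose m) \<le> real (n choose Suc j)"
      using Suc j by simp
    moreover have "(1 - real (Suc i) * (real (Suc i) + 1) / real m) * real (n choose m)
        = (1 - real i * (real i + 1) / real m) * real (n choose m)
          - real (2 * i + 2) / real m * real (n choose m)"
      using Suc.prems by (simp add: field_simps)
    ultimately show ?case by (simp add: j_def)
  qed simp
  have "n choose (m - i) \<le> n choose j"
  proof (cases "j \<le> m")
    case True
    then show ?thesis using assms by (intro binomial_mono) (auto simp: m_def)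
  next
    case False
    have jn: "j \<le> n" using assms div_mult_mod_eq[of n 2] by linarith
    have "n choose (m - i) \<le> n choose (n - j)"
    proof (rule binomial_mono)
      show "m - i \<le> n - j" "2 * (n - j) \<le> n"
        using assms False div_mult_mod_eq[of n 2] mod_less_divisor[of 2 n] unfolding m_def by linarith+
    qed
    then show ?thesis using binomial_symmetric[OF jn] by simp
  qed
  then have "real (n choose (m - i)) \<le> real (n choose j)" by simp
  with below[of i] assms have "(1 - real i * (real i + 1) / real m) * real (n choose m) \<le> real (n choose j)"
    by (simp add: m_def)
  then show ?thesis
    by (simp add: central_def m_def[symmetric] divide_right_mono)
qed

section \<open>The smoothed absolute value and its one-step inequality\<close>

definition hyp :: "real \<Rightarrow> real" where
  "hyp v = sqrt (v\<^sup>2 + 1)"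

lemma hyp_pos: "0 < hyp v" and hyp_square: "(hyp v)\<^sup>2 = v\<^sup>2 + 1"
  and abs_le_hyp: "\<bar>v\<bar> \<le> hyp v"
  by (auto simp: hyp_def add_nonneg_pos intro: real_le_rsqrt)

lemma hyp_minus [simp]: "hyp (- v) = hyp v"
  by (simp add: hyp_def)

text \<open>\<open>hyp v\<close> is the length of the plane vector \<open>(1, v)\<close>, so
  convexity is the triangle inequality.\<close>

lemma convex_hyp: "convex_on UNIV hyp"
proof (rule convex_onI)
  fix t x y :: real assume t: "0 < t" "t < 1"
  have hyp_eq: "hyp v = norm (Complex 1 v)" for v
    by (simp add: hyp_def complex_norm add.commute)
  have "Complex 1 ((1 - t) *\<^sub>R x + t *\<^sub>R y) = (1 - t) *\<^sub>R Complex 1 x + t *\<^sub>R Complex 1 y"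
    by (simp add: complex_eq_iff)
  then have "hyp ((1 - t) *\<^sub>R x + t *\<^sub>R y) \<le> norm ((1 - t) *\<^sub>R Complex 1 x) + norm (t *\<^sub>R Complex 1 y)"
    unfolding hyp_eq by (metis norm_triangle_ineq)
  then show "hyp ((1 - t) *\<^sub>R x + t *\<^sub>R y) \<le> (1 - t) * hyp x + t * hyp y"
    using t by (simp add: hyp_eq)
qed simp

text \<open>Both \<open>v + a\<close> and \<open>v - a\<close> are convex combinations of
  \<open>v - b\<close> and \<open>v + b\<close>, with weights exchanged; adding the two convexity
  bounds cancels \<open>t\<close>.\<close>

lemma hyp_spread_mono:
  assumes "\<bar>a\<bar> \<le> b"
  shows "hyp (v + a) + hyp (v - a) \<le> hyp (v + b) + hyp (v - b)"
proof (cases "b = 0")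
  case False
  then have b: "0 < b" using assms by auto
  define t where "t = (a / b + 1) / 2"
  have t: "0 \<le> t" "t \<le> 1" using assms b by (auto simp: t_def field_simps abs_le_iff)
  have tb: "t * b * 2 = a + b" using b by (simp add: t_def field_simps)
  have "(1 - t) *\<^sub>R (v - b) + t *\<^sub>R (v + b) = v - b + t * b * 2" by (simp add: algebra_simps)
  then have eq1: "(1 - t) *\<^sub>R (v - b) + t *\<^sub>R (v + b) = v + a" using tb by simp
  have "(1 - t) *\<^sub>R (v + b) + t *\<^sub>R (v - b) = v + b - t * b * 2" by (simp add: algebra_simps)
  then have eq2: "(1 - t) *\<^sub>R (v + b) + t *\<^sub>R (v - b) = v - a" using tb by simp
  have "hyp (v + a) \<le> (1 - t) * hyp (v - b) + t * hyp (v + b)"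
    using convex_onD[OF convex_hyp, of t "v - b" "v + b"] t eq1 by simp
  moreover have "hyp (v - a) \<le> (1 - t) * hyp (v + b) + t * hyp (v - b)"
    using convex_onD[OF convex_hyp, of t "v + b" "v - b"] t eq2 by simp
  ultimately show ?thesis by (simp add: algebra_simps)
qed (use assms in simp)

text \<open>The tangent line at \<open>v\<close>, of slope \<open>v / hyp v\<close>. It is
  Cauchy-Schwarz for the vectors \<open>(1, v)\<close> and \<open>(1, v + x)\<close>.\<close>

lemma hyp_tangent: "hyp v + v / hyp v * x \<le> hyp (v + x)"
proof -
  have "(1 + v * (v + x))\<^sup>2 \<le> (hyp v * hyp (v + x))\<^sup>2"
  proof -
    have "(hyp v * hyp (v + x))\<^sup>2 - (1 + v * (v + x))\<^sup>2 = x\<^sup>2"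
      by (simp add: power_mult_distrib hyp_square) (simp add: power2_eq_square algebra_simps)
    then show ?thesis using zero_le_power2[of x] by linarith
  qed
  then have "1 + v * (v + x) \<le> hyp v * hyp (v + x)"
    by (rule power2_le_imp_le) (simp add: hyp_pos less_imp_le)
  then have "hyp v * hyp v + v * x \<le> hyp v * hyp (v + x)"
    using hyp_square[of v] by (simp add: power2_eq_square algebra_simps)
  then show ?thesis using hyp_pos[of v] by (simp add: field_simps)
qed

lemma hyp_midpoint: "2 * hyp ((a + b) / 2) \<le> hyp a + hyp b"
  using convex_onD[OF convex_hyp, of "1/2" a b] by (simp add: field_simps)

text \<open>The tangent bounds the loss by \<open>hyp (v + x) - hyp v\<close>, midpoint convexity
  absorbs \<open>- hyp v\<close> by doubling the step to \<open>2 * x\<close>, and the spread grows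
  up to 2. The distance from 2 to \<open>C\<close> is left over as slack.\<close>

lemma hyp_move_le:
  assumes "\<bar>x\<bar> \<le> 1"
  shows "v / hyp v * x + hyp (v - x) \<le> (hyp (v + 2) + hyp (v - 2)) / 2"
proof -
  have "v / hyp v * x + hyp (v - x) \<le> hyp (v + x) + hyp (v - x) - hyp v"
    using hyp_tangent[of v x] by simp
  also have "\<dots> \<le> (hyp (v + 2 * x) + hyp (v - 2 * x)) / 2"
  proof -
    have "(v + (v + 2 * x)) / 2 = v + x" "(v + (v - 2 * x)) / 2 = v - x" by (simp_all add: field_simps)
    note mid = this
    from hyp_midpoint[of v "v + 2 * x"] hyp_midpoint[of v "v - 2 * x"]
    have "2 * hyp (v + x) \<le> hyp v + hyp (v + 2 * x)" "2 * hyp (v - x) \<le> hyp v + hyp (v - 2 * x)"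
      by (simp_all only: mid)
    then show ?thesis by simp
  qed
  also have "\<dots> \<le> (hyp (v + 2) + hyp (v - 2)) / 2"
  proof -
    have "\<bar>2 * x\<bar> \<le> 2" using assms by linarith
    from hyp_spread_mono[OF this, of v] show ?thesis by simp
  qed
  finally show ?thesis .
qed

text \<open>The window has length \<open>2 * C\<close>, which is the spacing of the values of
  \<open>C\<close> times a sum of a fixed number of signs, so a shifted walk meets it as long as the
  shift stays in range.\<close>

definition slack :: "real \<Rightarrow> real \<Rightarrow> real" where
  "slack C v = (if \<bar>v\<bar> \<le> C then 2 / 5 else 0)"

lemma hyp_sum_square: "(hyp (v + a) + hyp (v - a))\<^sup>2 = 2 * (v\<^sup>2 + a\<^sup>2 + 1) + 2 * (hyp (v + a) * hyp (v - a))"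
  and hyp_prod_square: "(hyp (v + a) * hyp (v - a))\<^sup>2 = (v\<^sup>2 - a\<^sup>2 + 1)\<^sup>2 + 4 * a\<^sup>2"
  by (simp_all add: power2_sum power_mult_distrib hyp_square)
     (simp_all add: power2_eq_square algebra_simps)

text \<open>
  The gain of at least \<open>2 / 5\<close> for \<open>\<bar>v\<bar> \<le> C\<close> is what pays for starting the potential from \<open>hyp\<close>
  instead of the absolute value.
\<close>

lemma hyp_move_slack:
  assumes x: "\<bar>x\<bar> \<le> 1" and C: "C\<^sup>2 = 32" "0 \<le> C"
  shows "v / hyp v * x + hyp (v - x) + slack C v \<le> (hyp (v + C) + hyp (v - C)) / 2"
proof (cases "\<bar>v\<bar> \<le> C")
  case False
  have "2 \<le> C" using C by (intro power2_le_imp_le[of 2 C]) auto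
  with False hyp_move_le[OF x, of v] hyp_spread_mono[of 2 C v] show ?thesis by (simp add: slack_def)
next
  case True
  have "v\<^sup>2 \<le> 32" using True C abs_le_square_iff[of v C] by simp
  \<comment> \<open>By \<open>hyp_sum_square\<close> the two spreads are compared through these
    products. Here \<open>P ^ 2 \<ge> 4 * C ^ 2 = 128\<close>, and \<open>v ^ 2 \<le> 32\<close>
    gives \<open>D ^ 2 \<le> 29 ^ 2 + 16 = 857\<close>; the decimals are roundings of the square
    roots.\<close>
  define P D where "P = hyp (v + C) * hyp (v - C)" and "D = hyp (v + 2) * hyp (v - 2)"
  have "(113/10)\<^sup>2 \<le> P\<^sup>2"
    unfolding P_def hyp_prod_square C using zero_le_power2[of "v\<^sup>2 - 32 + 1"]
    by (simp add: power2_eq_square[of "113/10"])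
  then have P: "113/10 \<le> P"
    by (rule power2_le_imp_le) (simp add: P_def hyp_pos less_imp_le)
  have "D\<^sup>2 = (v\<^sup>2 - 3)\<^sup>2 + 16"
    by (simp add: D_def hyp_prod_square)
  also have "(v\<^sup>2 - 3)\<^sup>2 \<le> 29\<^sup>2"
  proof (rule iffD1[OF abs_le_square_iff])
    show "\<bar>v\<^sup>2 - 3\<bar> \<le> \<bar>29\<bar>"
      using \<open>v\<^sup>2 \<le> 32\<close> zero_le_power2[of v] by linarith
  qed
  also have "29\<^sup>2 + 16 \<le> (293/10 :: real)\<^sup>2"
    by (simp add: power2_eq_square)
  finally have D: "D \<le> 293/10"
    by (rule power2_le_imp_le) simp_all
  have E2: "(hyp (v + 2) + hyp (v - 2))\<^sup>2 = 2 * v\<^sup>2 + 10 + 2 * D"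
    by (simp add: hyp_sum_square D_def)
  also have "\<dots> \<le> 13456 / 100"
    using \<open>v\<^sup>2 \<le> 32\<close> D by simp
  also have "\<dots> = (116/10)\<^sup>2"
    by (simp add: power2_eq_square)
  finally have "hyp (v + 2) + hyp (v - 2) \<le> 116/10"
    by (rule power2_le_imp_le) simp
  then have "2 * v\<^sup>2 + 10 + 2 * D + 16/25 + 8/5 * (hyp (v + 2) + hyp (v - 2)) \<le> 2 * v\<^sup>2 + 66 + 2 * P"
    using P D by argo
  moreover have "(hyp (v + 2) + hyp (v - 2) + 4/5)\<^sup>2
      = 2 * v\<^sup>2 + 10 + 2 * D + 16/25 + 8/5 * (hyp (v + 2) + hyp (v - 2))"
    unfolding power2_sum[of "hyp (v + 2) + hyp (v - 2)" "4/5"] E2 by (simp add: power2_eq_square)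
  ultimately have "(hyp (v + 2) + hyp (v - 2) + 4/5)\<^sup>2 \<le> 2 * v\<^sup>2 + 66 + 2 * P"
    by simp
  also have "\<dots> = (hyp (v + C) + hyp (v - C))\<^sup>2"
    by (simp add: hyp_sum_square P_def C)
  finally have "hyp (v + 2) + hyp (v - 2) + 4/5 \<le> hyp (v + C) + hyp (v - C)"
    by (rule power2_le_imp_le) (simp add: hyp_pos less_imp_le add_nonneg_nonneg)
  with hyp_move_le[OF x, of v] True show ?thesis by (simp add: slack_def)
qed

section \<open>The initial excess of \<open>hyp\<close> over the absolute value and its
  compensation\<close>

lemma hyp_excess: "hyp v - \<bar>v\<bar> \<le> 1" "v \<noteq> 0 \<Longrightarrow> hyp v - \<bar>v\<bar> \<le> 1 / (2 * \<bar>v\<bar>)"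
proof -
  have "hyp v \<le> \<bar>v\<bar> + 1"
    unfolding hyp_def by (intro real_le_lsqrt) (auto simp: power2_sum)
  then show "hyp v - \<bar>v\<bar> \<le> 1" by simp
  assume "v \<noteq> 0"
  then have "hyp v \<le> \<bar>v\<bar> + 1 / (2 * \<bar>v\<bar>)"
    unfolding hyp_def by (intro real_le_lsqrt) (auto simp: power2_sum)
  then show "hyp v - \<bar>v\<bar> \<le> 1 / (2 * \<bar>v\<bar>)" by simp
qed

text \<open>An unweighted sum over the lattice: every binomial weight is later bounded by
  \<open>central T\<close>.\<close>

definition lattice_excess :: "real \<Rightarrow> nat \<Rightarrow> real" where
  "lattice_excess C T = (\<Sum>j\<le>T. hyp (C * (2 * real j - real T)) - \<bar>C * (2 * real j - real T)\<bar>)"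

lemma lattice_excess_1_le: "0 < C \<Longrightarrow> lattice_excess C (Suc 0) \<le> 1 / C"
  using hyp_excess(2)[of C] by (simp add: lattice_excess_def)

text \<open>Induction in steps of two, since the lattice for \<open>T\<close> is the one for
  \<open>T - 2\<close> with the two points \<open>C * T\<close> and \<open>- C * T\<close> added.
  Together these cost at most \<open>1 / (C * T) \<le> 1 / (8 * sqrt T)\<close>. A square-root bound
  is sufficient because about \<open>sqrt T\<close> rounds will pay for it.\<close>

lemma lattice_excess_le:
  assumes C: "C\<^sup>2 = 32" "0 < C"
  shows "lattice_excess C T \<le> 1 + sqrt T / 8"
proof (induction T rule: nat_less_induct)
  case (1 T)
  consider "T = 0" | "T = 1" | n where "T = Suc (Suc n)"
    by (metis One_nat_def not0_implies_Suc)
  then show ?case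
  proof cases
    case 1
    then show ?thesis by (simp add: lattice_excess_def hyp_def)
  next
    case 2
    have "1 \<le> C" using C by (intro power2_le_imp_le[of 1 C]) auto
    then have "1 / C \<le> 1" by simp
    with 2 lattice_excess_1_le[OF C(2)] show ?thesis by simp
  next
    case 3
    define h where "h r = hyp (C * r) - \<bar>C * r\<bar>" for r
    have "lattice_excess C T = (\<Sum>j\<le>Suc (Suc n). h (2 * real j - real (Suc (Suc n))))"
      by (simp only: lattice_excess_def h_def 3)
    also have "\<dots> = h (- real T) + (\<Sum>j\<le>n. h (2 * real j - real n)) + h (real T)"
      by (subst sum.atMost_Suc, subst sum.atMost_Suc_shift) (simp add: 3 algebra_simps)
    also have "h (- real T) = h (real T)"
      by (simp add: h_def)
    also have "(\<Sum>j\<le>n. h (2 * real j - real n)) = lattice_excess C n"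
      by (simp only: lattice_excess_def h_def)
    also have "lattice_excess C n \<le> 1 + sqrt n / 8"
      using 1 3 by simp
    also have "h (real T) \<le> 1 / (2 * (C * real T))"
      unfolding h_def using hyp_excess(2)[of "C * real T"] C 3 by (simp add: abs_mult)
    finally have le: "lattice_excess C T \<le> 1 + sqrt n / 8 + 1 / (C * real T)"
      by (simp add: field_simps)
    have "8 \<le> C * sqrt T"
    proof (rule power2_le_imp_le)
      show "8\<^sup>2 \<le> (C * sqrt (real T))\<^sup>2"
        using 3 by (simp add: power_mult_distrib C)
    qed (use C in auto)
    then have "8 * sqrt T \<le> C * real T"
      using mult_right_mono[of 8 "C * sqrt T" "sqrt T"] by (simp add: mult.assoc)
    then have "1 / (C * real T) \<le> 1 / (8 * sqrt T)"
      using 3 C by (intro divide_left_mono) auto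
    \<comment> \<open>After multiplication by \<open>sqrt T\<close> this says that the geometric
      mean of \<open>T - 2\<close> and \<open>T\<close> is at most \<open>T - 1\<close>.\<close>
    moreover have "sqrt n + 1 / sqrt T \<le> sqrt T"
    proof -
      have "sqrt n * sqrt T \<le> real n + 1"
        unfolding real_sqrt_mult[symmetric] using 3
        by (intro real_le_lsqrt) (auto simp: power2_eq_square algebra_simps)
      then have "(sqrt n + 1 / sqrt T) * sqrt T \<le> sqrt T * sqrt T"
        using 3 by (simp add: distrib_right)
      then show ?thesis by (rule mult_right_le_imp_le) (use 3 in simp)
    qed
    ultimately show ?thesis using le by simp
  qed
qed

lemma coin_walk_excess_le:
  "coin_walk T (\<lambda>r. hyp (C * r)) \<le> coin_walk T (\<lambda>r. \<bar>C * r\<bar>) + central T * lattice_excess C T"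
proof -
  have "coin_walk T (\<lambda>r. hyp (C * r))
      = coin_walk T (\<lambda>r. \<bar>C * r\<bar>) + coin_walk T (\<lambda>r. hyp (C * r) - \<bar>C * r\<bar>)"
    by (simp add: coin_walk_add[symmetric])
  also have "coin_walk T (\<lambda>r. hyp (C * r) - \<bar>C * r\<bar>) \<le> central T * lattice_excess C T"
    unfolding coin_walk_def lattice_excess_def sum_distrib_left
    by (intro sum_mono mult_right_mono binomial_le_central) (simp add: abs_le_hyp)
  finally show ?thesis by simp
qed

text \<open>Some lattice value lies within \<open>C\<close> of \<open>s\<close>, and the bound on
  \<open>s\<close> keeps its index within \<open>i\<close> steps of the middle. Only this atom of
  the walk is kept.\<close>

lemma coin_walk_slack_ge:
  assumes C: "0 < C" and s: "\<bar>s\<bar> < C * (2 * real i + 1)" and i: "2 * i \<le> n"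
  shows "2 / 5 * ((1 - real i * (real i + 1) / real (n div 2)) * central n)
    \<le> coin_walk n (\<lambda>r. slack C (- s + C * r))"
proof -
  define y where "y = s / C"
  have "\<bar>y\<bar> < 2 * real i + 1" and sy: "s = C * y"
    using s C by (auto simp: y_def abs_divide field_simps)
  then have y: "y < 2 * real i + 1" "- (2 * real i + 1) < y" by linarith+
  \<comment> \<open>Rounding chosen so that \<open>2 * k - n\<close> is within 1 of
    \<open>y\<close>. The strict bounds on \<open>y\<close> then force \<open>k\<close> into the
    range from 0 to \<open>n\<close>.\<close>
  define k where "k = \<lfloor>(y + real n + 1) / 2\<rfloor>"
  have k: "real_of_int k \<le> (y + real n + 1) / 2" "(y + real n + 1) / 2 < real_of_int k + 1"
    unfolding k_def by linarith+
  have "2 * real i \<le> real n" using i by linarith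
  then have "0 < (y + real n + 1) / 2" "(y + real n + 1) / 2 < real n + 1"
    using y by (simp_all add: field_simps)
  then have "real_of_int (-1) < real_of_int k" "real_of_int k < real_of_int (int n + 1)"
    using k by simp_all
  then have "0 \<le> k" "k \<le> int n"
    by (simp_all only: of_int_less_iff)
  then obtain j where j: "k = int j" "j \<le> n" by (metis nat_0_le nat_le_iff)
  have "real n < 2 * real j + 2 * real i + 2" "2 * real j < real n + 2 * real i + 2"
    using k y unfolding j by (simp_all add: field_simps abs_less_iff)
  then have j': "n < 2 * j + 2 * i + 2" "2 * j < n + 2 * i + 2" by linarith+
  have "n div 2 \<le> j + i" "j \<le> n div 2 + i + n mod 2" "i \<le> n div 2"
    using j' i by presburger+
  then have "(1 - real i * (real i + 1) / real (n div 2)) * central n \<le> real (n choose j) / 2 ^ n"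
    by (rule binomial_near_central)
  moreover have "real (n choose j) / 2 ^ n * slack C (- s + C * (2 * real j - real n))
      \<le> coin_walk n (\<lambda>r. slack C (- s + C * r))"
    using j by (intro coin_walk_ge_single[where g="\<lambda>r. slack C (- s + C * r)"]) (auto simp: slack_def)
  moreover have "\<bar>- s + C * (2 * real j - real n)\<bar> \<le> C"
  proof -
    have "\<bar>- y + (2 * real j - real n)\<bar> \<le> 1" using k unfolding j by (simp add: field_simps abs_le_iff)
    then have "C * \<bar>- y + (2 * real j - real n)\<bar> \<le> C * 1" using C by (intro mult_left_mono) auto
    moreover have "- s + C * (2 * real j - real n) = C * (- y + (2 * real j - real n))"
      by (simp add: sy algebra_simps)
    ultimately show ?thesis using C by (simp add: abs_mult)
  qed
  ultimately show ?thesis by (simp add: slack_def)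
qed

text \<open>
  The left-hand side is of order \<open>central T * ln T\<close>, whereas each of the first rounds contributes
  a multiple of \<open>central T\<close> on the right, because \<open>s t\<close> cannot move by more than one per round. For
  \<open>T < 100\<close> at most six rounds suffice, and then \<open>\<bar>s t\<bar> < C\<close>; for large \<open>T\<close> the first \<open>sqrt T\<close> rounds do,
  during which the relevant binomial coefficients stay comparable with the central one.
\<close>

lemma excess_le_total_slack:
  assumes C: "C\<^sup>2 = 32" "0 < C" and T: "0 < T"
    and s: "\<And>t. t \<in> {1..T} \<Longrightarrow> \<bar>s t\<bar> \<le> real t - 1"
  shows "central T * lattice_excess C T
    \<le> (\<Sum>t\<in>{1..T}. coin_walk (T - t) (\<lambda>r. slack C (- s t + C * r)))"
proof -
  let ?W = "\<lambda>t. coin_walk (T - t) (\<lambda>r. slack C (- s t + C * r))"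
  have C5: "5 < C" using C by (intro power_less_imp_less_base[of 5 2 C]) auto
  have W_nonneg: "0 \<le> ?W t" for t by (rule coin_walk_nonneg) (simp add: slack_def)
  \<comment> \<open>For \<open>t \<le> 6\<close> the shift is at most 5, hence below
    \<open>C\<close>, and \<open>i = 0\<close> applies without loss in the binomial weight.\<close>
  have W_central: "2 / 5 * central (T - t) \<le> ?W t" if "t \<in> {1..T}" "t \<le> 6" for t
    using coin_walk_slack_ge[OF C(2), of "s t" 0 "T - t"] s[OF that(1)] that C5 by simp
  have prefix: "(\<Sum>t\<in>{1..K}. ?W t) \<le> (\<Sum>t\<in>{1..T}. ?W t)" if "K \<le> T" for K
    using that W_nonneg by (intro sum_mono2) auto
  have prefix_const: "c * real K \<le> (\<Sum>t\<in>{1..T}. ?W t)"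
    if "K \<le> T" "\<And>t. t \<in> {1..K} \<Longrightarrow> c \<le> ?W t" for K c
    using sum_mono[of "{1..K}" "\<lambda>_. c" ?W] that(2) prefix[OF that(1)] by (simp add: mult.commute)
  have excess: "central T * lattice_excess C T \<le> central T * (1 + sqrt T / 8)"
    by (intro mult_left_mono lattice_excess_le C central_nonneg)
  \<comment> \<open>The target is \<open>1 + sqrt T / 8\<close> in units of
    \<open>central T\<close>. Four rounds give 8/5, enough for \<open>sqrt T \<le> 3\<close>; six
    give 12/5, enough for \<open>sqrt T \<le> 10\<close>. For \<open>T\<close> up to 3 the weights
    are computed, and \<open>T = 1\<close> uses the sharper bound \<open>1 / C\<close>.\<close>
  consider "T = 1" | "T = 2" | "T = 3" | "4 \<le> T" "T < 6" | "6 \<le> T" "T < 100" | "100 \<le> T"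
    using T by linarith
  then show ?thesis
  proof cases
    case 1
    have "lattice_excess C T \<le> 1 / C" using lattice_excess_1_le C 1 by simp
    also have "\<dots> \<le> 2 / 5" using C5 by (simp add: field_simps)
    also have "\<dots> \<le> ?W 1" using W_central[of 1] 1 by (simp add: central_def)
    finally have "lattice_excess C T \<le> ?W 1" .
    moreover have "central T \<le> 1" using central_antimono[of 0 T] by (simp add: central_def)
    ultimately show ?thesis
      using mult_right_mono[of "central T" 1 "?W 1"] W_nonneg[of 1] central_nonneg[of T] 1
        mult_left_mono[of "lattice_excess C T" "?W 1" "central T"] by simp
  next
    case 2
    have "sqrt T \<le> 8/5" using 2 by (intro real_le_lsqrt) (simp_all add: power2_eq_square)
    then have "central T * (1 + sqrt T / 8) \<le> 2 / 5 * (1 / 2) + 2 / 5"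
      using 2 by (simp add: central_def)
    moreover have "central 1 = 1 / 2" "central 0 = 1"
      by (simp_all add: central_def)
    moreover have "(\<Sum>t\<in>{1..T}. ?W t) = ?W 1 + ?W 2" using 2 by (simp add: numeral_2_eq_2)
    moreover have "2 / 5 * central 1 \<le> ?W 1" "2 / 5 * central 0 \<le> ?W 2"
      using W_central[of 1] W_central[of 2] 2 by simp_all
    ultimately show ?thesis using excess by linarith
  next
    case 3
    have "sqrt T \<le> 2" using 3 by (intro real_le_lsqrt) (simp_all add: power2_eq_square)
    then have "central T * (1 + sqrt T / 8) \<le> 2 / 5 * (1 / 2) + 2 / 5 * (1 / 2) + 2 / 5"
      using 3 by (simp add: central_def)
    moreover have "central 2 = 1 / 2" "central 1 = 1 / 2" "central 0 = 1"
      by (simp_all add: central_def)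
    moreover have "(\<Sum>t\<in>{1..T}. ?W t) = ?W 1 + ?W 2 + ?W 3" using 3 by (simp add: eval_nat_numeral)
    moreover have "2 / 5 * central 2 \<le> ?W 1" "2 / 5 * central 1 \<le> ?W 2" "2 / 5 * central 0 \<le> ?W 3"
      using W_central[of 1] W_central[of 2] W_central[of 3] 3 by simp_all
    ultimately show ?thesis using excess by linarith
  next
    case 4
    have "sqrt T \<le> 3" using 4 by (intro real_le_lsqrt) (simp_all add: power2_eq_square)
    then have "central T * (1 + sqrt T / 8) \<le> central T * (8 / 5)"
      by (intro mult_left_mono central_nonneg) simp
    also have "\<dots> \<le> 2 / 5 * central T * real 4" by simp
    also have "\<dots> \<le> (\<Sum>t\<in>{1..T}. ?W t)"
    proof (rule prefix_const)
      fix t :: nat assume t: "t \<in> {1..4}"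
      have "2 / 5 * central T \<le> 2 / 5 * central (T - t)" by (simp add: central_antimono)
      also have "\<dots> \<le> ?W t" using t 4 by (intro W_central) auto
      finally show "2 / 5 * central T \<le> ?W t" .
    qed (use 4 in simp)
    finally show ?thesis using excess by linarith
  next
    case 5
    have "sqrt T \<le> 10" using 5 by (intro real_le_lsqrt) simp_all
    then have "central T * (1 + sqrt T / 8) \<le> central T * (12 / 5)"
      by (intro mult_left_mono central_nonneg) simp
    also have "\<dots> \<le> 2 / 5 * central T * real 6" by simp
    also have "\<dots> \<le> (\<Sum>t\<in>{1..T}. ?W t)"
    proof (rule prefix_const)
      fix t :: nat assume t: "t \<in> {1..6}"
      have "2 / 5 * central T \<le> 2 / 5 * central (T - t)" by (simp add: central_antimono)
      also have "\<dots> \<le> ?W t" using t 5 by (intro W_central) auto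
      finally show "2 / 5 * central T \<le> ?W t" .
    qed (use 5 in simp)
    finally show ?thesis using excess by linarith
  next
    case 6
    define u where "u = sqrt T"
    have u: "10 \<le> u" "u * u = real T"
      using 6 by (auto simp: u_def intro!: real_le_rsqrt)
    \<comment> \<open>The first \<open>K\<close> rounds have shift below \<open>u\<close>. With
      \<open>i\<close> about \<open>u / 10\<close>, the reach \<open>5 * (2 * i + 1)\<close> exceeds
      \<open>u\<close>, while \<open>i * (i + 1)\<close> is at most \<open>6 / 100 * T\<close>, a
      small part of \<open>n div 2\<close>. So each round keeps 4/5 of the full gain, which is 8/25
      of \<open>central T\<close>.\<close>
    define K where "K = nat \<lfloor>u\<rfloor>"
    have K: "real K \<le> u" "u - 1 \<le> real K" unfolding K_def using u by linarith+
    define i where "i = nat \<lceil>u / 10\<rceil>"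
    have i: "u / 10 \<le> real i" "real i \<le> u / 10 + 1" unfolding i_def using u by linarith+
    have uu: "10 * u \<le> u * u" using u by (intro mult_right_mono) auto
    have KT: "K \<le> T" using K u uu by linarith
    have "8 / 25 * central T * real K \<le> (\<Sum>t\<in>{1..T}. ?W t)"
    proof (rule prefix_const[OF KT])
      fix t assume t: "t \<in> {1..K}"
      then have tT: "t \<in> {1..T}" using KT by auto
      define n where "n = T - t"
      have n: "u * u - u \<le> real n"
      proof -
        have "real n = real T - real t" using tT by (simp add: n_def of_nat_diff)
        moreover have "real t \<le> real K" using t by simp
        ultimately show ?thesis using K u by linarith
      qed
      have "2 * i \<le> n"
      proof -
        have "2 * real i \<le> real n" using n i u uu by linarith
        then show ?thesis by linarith
      qed
      moreover have "\<bar>s t\<bar> < C * (2 * real i + 1)"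
      proof -
        have "\<bar>s t\<bar> < u" using s[OF tT] t K by auto
        also have "u \<le> 5 * (2 * real i + 1)" using i by (simp add: field_simps)
        also have "\<dots> \<le> C * (2 * real i + 1)" using C5 by (intro mult_right_mono) auto
        finally show ?thesis .
      qed
      ultimately have "2 / 5 * ((1 - real i * (real i + 1) / real (n div 2)) * central n) \<le> ?W t"
        unfolding n_def by (intro coin_walk_slack_ge C)
      moreover have "4 / 5 * central T \<le> (1 - real i * (real i + 1) / real (n div 2)) * central n"
      proof (rule mult_mono)
        have m: "u * u * (44 / 100) \<le> real (n div 2)"
        proof -
          have "n \<le> 2 * (n div 2) + 1" by presburger
          then have "real n \<le> 2 * real (n div 2) + 1" by linarith
          moreover have "1 \<le> u * u / 100" using u uu by linarith
          moreover have "u \<le> u * u / 10" using uu by linarith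
          ultimately show ?thesis using n by linarith
        qed
        have "real i * (real i + 1) \<le> (u / 5) * (u / 5 + u / 10)"
          using i u by (intro mult_mono) auto
        also have "\<dots> = 6 / 100 * (u * u)" by simp
        also have "\<dots> \<le> 1 / 5 * real (n div 2)" using m by linarith
        finally have le: "real i * (real i + 1) \<le> 1 / 5 * real (n div 2)" .
        have "0 < u * u" using u(1) by simp
        then have "0 < real (n div 2)" using m by linarith
        with le have "real i * (real i + 1) / real (n div 2) \<le> 1 / 5"
          by (simp only: divide_le_eq if_True)
        then show "4 / 5 \<le> 1 - real i * (real i + 1) / real (n div 2)" by linarith
        then show "0 \<le> 1 - real i * (real i + 1) / real (n div 2)" by linarith
      qed (simp_all add: n_def central_antimono central_nonneg)
      ultimately have "2 / 5 * (4 / 5 * central T) \<le> ?W t"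
        by (meson order_trans mult_left_mono divide_nonneg_nonneg zero_le_numeral)
      then show "8 / 25 * central T \<le> ?W t" by simp
    qed
    \<comment> \<open>Here \<open>K \<ge> u - 1\<close> and \<open>u \<ge> 10\<close> give
      \<open>1 + u / 8 \<le> 8 / 25 * (u - 1)\<close>.\<close>
    moreover have "central T * (1 + u / 8) \<le> central T * (8 / 25 * real K)"
      using K u by (intro mult_left_mono central_nonneg) linarith
    moreover have "central T * (8 / 25 * real K) = 8 / 25 * central T * real K"
      by simp
    ultimately show ?thesis using excess unfolding u_def by linarith
  qed
qed

text \<open>The potential built from \<open>hyp\<close> telescopes and collects the slack of every
  round. Its final value dominates the absolute sum of the moves, and its initial excess is covered
  by the collected slack.\<close>

lemma path_regret_real:
  fixes x :: "nat \<Rightarrow> real"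
  assumes C: "C\<^sup>2 = 32" "0 < C" and x: "\<And>t. t \<in> {1..T} \<Longrightarrow> \<bar>x t\<bar> \<le> 1"
  defines "v t r \<equiv> - (\<Sum>i\<in>{1..<t}. x i) + C * r"
  shows "(\<Sum>t\<in>{1..T}. coin_walk (T - t) (\<lambda>r. v t r / hyp (v t r) * x t)) + \<bar>\<Sum>t\<in>{1..T}. x t\<bar>
    \<le> coin_walk T (\<lambda>r. \<bar>C * r\<bar>)"
proof (cases "T = 0")
  case False
  let ?F = "\<lambda>t. coin_walk (T - t) (\<lambda>r. v t r / hyp (v t r) * x t)"
  let ?W = "\<lambda>t. coin_walk (T - t) (\<lambda>r. slack C (v t r))"
  \<comment> \<open>The index \<open>Suc t\<close> is deliberate: \<open>v t\<close> contains only
    the moves before round \<open>t\<close>, so \<open>?U t\<close> is the potential after round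
    \<open>t\<close>.\<close>
  let ?U = "\<lambda>t. coin_walk (T - t) (\<lambda>r. hyp (v (Suc t) r))"
  have step: "?F (Suc m) + ?W (Suc m) + ?U (Suc m) \<le> ?U m" if "m < T" for m
  proof -
    have sum: "v (Suc (Suc m)) r = v (Suc m) r - x (Suc m)" for r
      by (simp add: v_def)
    have n: "T - m = Suc (T - Suc m)" using that by simp
    have "?F (Suc m) + ?W (Suc m) + ?U (Suc m)
        = coin_walk (T - Suc m) (\<lambda>r. v (Suc m) r / hyp (v (Suc m) r) * x (Suc m)
            + hyp (v (Suc m) r - x (Suc m)) + slack C (v (Suc m) r))"
      unfolding sum coin_walk_add by simp
    also have "\<dots> \<le> coin_walk (T - Suc m) (\<lambda>r. (hyp (v (Suc m) r + C) + hyp (v (Suc m) r - C)) / 2)"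
      using that C by (intro coin_walk_mono hyp_move_slack x) auto
    also have "\<dots> = ?U m"
      unfolding n coin_walk_Suc by (simp add: v_def algebra_simps)
    finally show ?thesis .
  qed
  have "(\<Sum>t\<in>{1..m}. ?F t + ?W t) + ?U m \<le> ?U 0" if "m \<le> T" for m
    using that
  proof (induction m)
    case (Suc m)
    with step[of m] show ?case by simp
  qed simp
  from this[of T] have tele: "(\<Sum>t\<in>{1..T}. ?F t) + (\<Sum>t\<in>{1..T}. ?W t) + ?U T \<le> ?U 0"
    by (simp add: sum.distrib)
  have "\<bar>\<Sum>t\<in>{1..T}. x t\<bar> \<le> ?U T"
    using abs_le_hyp[of "\<Sum>t\<in>{1..T}. x t"] by (simp add: v_def atLeastLessThanSuc_atLeastAtMost)
  moreover have "?U 0 \<le> coin_walk T (\<lambda>r. \<bar>C * r\<bar>) + central T * lattice_excess C T"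
    using coin_walk_excess_le[of T C] by (simp add: v_def)
  moreover have "central T * lattice_excess C T \<le> (\<Sum>t\<in>{1..T}. ?W t)"
    unfolding v_def
  proof (rule excess_le_total_slack[OF C])
    fix t assume t: "t \<in> {1..T}"
    have "\<bar>\<Sum>i\<in>{1..<t}. x i\<bar> \<le> (\<Sum>i\<in>{1..<t}. \<bar>x i\<bar>)" by (rule sum_abs)
    also have "\<dots> \<le> (\<Sum>i\<in>{1..<t}. 1)" using t by (intro sum_mono x) auto
    also have "\<dots> = real t - 1" using t by (simp add: of_nat_diff)
    finally show "\<bar>\<Sum>i\<in>{1..<t}. x i\<bar> \<le> real t - 1" .
  qed (use False in simp)
  ultimately show ?thesis using tele by linarith
qed simp

section \<open>Transfer from the line to fair coins\<close>

lemma walk_one_dim: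
  fixes b :: "'a::euclidean_space"
  assumes b: "(Basis :: 'a set) = {b}" and I: "finite I" and g: "continuous_on UNIV g"
  shows "walk I g = coin_walk (card I) (\<lambda>r. g (r *\<^sub>R b))"
  using I g
proof (induction I arbitrary: g)
  case (insert i I)
  have [measurable]: "g \<in> borel_measurable borel"
    using insert.prems by (rule borel_measurable_continuous_onI)
  have step: "(\<integral>y. g (s + y) \<partial>uniform_sphere) = (g (s + b) + g (s - b)) / 2" for s
  proof -
    have "(\<integral>y. g (s + y) \<partial>uniform_sphere) = (\<integral>y. (g (s + y) + g (s + - y)) / 2 \<partial>uniform_sphere)"
      by (rule integral_uniform_sphere_symmetrize)
         (auto intro!: continuous_intros continuous_on_compose2[OF insert.prems])
    \<comment> \<open>The sphere is the pair \<open>b\<close>, \<open>- b\<close>, on which the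
      symmetrized integrand is constant; the fair coin appears without computing point
      masses.\<close>
    also have "\<dots> = (\<integral>y. (g (s + b) + g (s - b)) / 2 \<partial>(uniform_sphere :: 'a measure))"
    proof (rule integral_cong_AE)
      show "AE y in uniform_sphere. (g (s + y) + g (s + - y)) / 2 = (g (s + b) + g (s - b)) / 2"
        using AE_uniform_sphere
      proof eventually_elim
        case (elim y)
        have y: "y = (y \<bullet> b) *\<^sub>R b" using euclidean_representation[of y] unfolding b by simp
        have "b \<in> Basis" unfolding b by simp
        then have "norm y = \<bar>y \<bullet> b\<bar>" by (subst y) simp
        with elim have "y \<bullet> b = 1 \<or> y \<bullet> b = -1" by (auto simp: abs_if split: if_splits)
        then have "y = b \<or> y = - b" using y by (metis scaleR_minus1_left scaleR_one)
        then show ?case by auto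
      qed
    qed measurable
    finally show ?thesis by (simp add: US.prob_space)
  qed
  have "walk (insert i I) g = walk I (\<lambda>s. (g (s + b) + g (s - b)) / 2)"
    using insert by (subst walk_insert) (simp_all add: step)
  also have "\<dots> = coin_walk (card I) (\<lambda>r. (g (r *\<^sub>R b + b) + g (r *\<^sub>R b - b)) / 2)"
    by (rule insert.IH) (auto intro!: continuous_intros continuous_on_compose2[OF insert.prems])
  also have "\<dots> = coin_walk (card (insert i I)) (\<lambda>r. g (r *\<^sub>R b))"
    using insert by (simp add: coin_walk_Suc scaleR_left_distrib scaleR_left_diff_distrib)
  finally show ?case .
qed simp

lemma path_regret_one_dim:
  fixes x :: "nat \<Rightarrow> 'a::euclidean_space"
  assumes dim: "DIM('a) = 1" and C: "C\<^sup>2 = 32" "0 < C"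
    and x: "\<And>t. t \<in> {1..T} \<Longrightarrow> norm (x t) \<le> 1"
  shows "(\<Sum>t\<in>{1..T}. walk {t<..T} (\<lambda>z. soft_normalize (- (\<Sum>i\<in>{1..<t}. x i) + C *\<^sub>R z) \<bullet> x t))
      + norm (\<Sum>t\<in>{1..T}. x t) \<le> C * walk {1..T} (norm :: 'a \<Rightarrow> real)"
proof -
  obtain b :: 'a where B: "Basis = {b}" using dim by (rule card_1_singletonE)
  have b: "b \<in> Basis" unfolding B by simp
  then have bb: "b \<bullet> b = 1" "norm b = 1" by simp_all
  define y where "y t = x t \<bullet> b" for t
  have xy: "x t = y t *\<^sub>R b" for t
    using euclidean_representation[of "x t"] unfolding B by (simp add: y_def)
  have soft: "soft_normalize (r *\<^sub>R b) = (r / hyp r) *\<^sub>R b" for r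
    by (simp add: soft_normalize_def hyp_def bb divide_inverse mult.commute)
  have v: "- (\<Sum>i\<in>A. x i) + C *\<^sub>R (r *\<^sub>R b) = (- (\<Sum>i\<in>A. y i) + C * r) *\<^sub>R b" for A r
    by (simp add: xy scaleR_sum_left[symmetric] scaleR_left_distrib scaleR_left_diff_distrib)
  have F: "walk {t<..T} (\<lambda>z. soft_normalize (- (\<Sum>i\<in>{1..<t}. x i) + C *\<^sub>R z) \<bullet> x t)
      = coin_walk (T - t) (\<lambda>r. (- (\<Sum>i\<in>{1..<t}. y i) + C * r)
          / hyp (- (\<Sum>i\<in>{1..<t}. y i) + C * r) * y t)" for t
  proof -
    have "walk {t<..T} (\<lambda>z. soft_normalize (- (\<Sum>i\<in>{1..<t}. x i) + C *\<^sub>R z) \<bullet> x t)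
      = coin_walk (card {t<..T}) (\<lambda>r. soft_normalize (- (\<Sum>i\<in>{1..<t}. x i) + C *\<^sub>R (r *\<^sub>R b)) \<bullet> x t)"
      by (rule walk_one_dim[OF B]) (auto intro!: continuous_intros)
    then show ?thesis
      unfolding v soft xy[of t] by (simp add: bb mult.commute)
  qed
  have "norm (\<Sum>t\<in>{1..T}. x t) = \<bar>\<Sum>t\<in>{1..T}. y t\<bar>"
    by (simp add: xy scaleR_sum_left[symmetric] bb)
  moreover have "C * walk {1..T} (norm :: 'a \<Rightarrow> real) = coin_walk T (\<lambda>r. \<bar>C * r\<bar>)"
    using C by (simp add: walk_one_dim[OF B] continuous_on_norm_id bb abs_mult coin_walk_cmult)
  moreover have "\<bar>y t\<bar> \<le> 1" if "t \<in> {1..T}" for t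
    using x[OF that] xy[of t] bb by simp
  ultimately show ?thesis
    unfolding F using path_regret_real[OF C, of T y] by simp
qed

section \<open>Adaptive opponents\<close>

lemma INF_inner_cball:
  fixes s :: "'a::euclidean_space"
  shows "(INF g\<in>cball 0 1. g \<bullet> s) = - norm s"
proof (rule cInf_eq_minimum)
  have "(- sgn s) \<bullet> s = - norm s"
    by (cases "s = 0") (simp_all add: sgn_div_norm power2_norm_eq_inner[symmetric] power2_eq_square)
  moreover have "- sgn s \<in> cball 0 1"
    by (simp add: norm_sgn)
  ultimately show "- norm s \<in> (\<lambda>g. g \<bullet> s) ` cball 0 1"
    by (metis image_eqI)
next
  fix r assume "r \<in> (\<lambda>g. g \<bullet> s) ` cball 0 1"
  then obtain g where g: "norm g \<le> 1" "r = g \<bullet> s" by auto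
  have "\<bar>g \<bullet> s\<bar> \<le> norm g * norm s" by (rule Cauchy_Schwarz_ineq2)
  also have "\<dots> \<le> norm s" using g mult_right_mono[of "norm g" 1 "norm s"] by simp
  finally show "- norm s \<le> r" using g by simp
qed

lemma regret_cball:
  "regret T f x (cball 0 1) = (\<Sum>t\<in>{1..T}. f t \<bullet> x t) + norm (\<Sum>t\<in>{1..T}. x t)"
  by (simp add: regret_def inner_sum_right[symmetric] INF_inner_cball)

lemma learner_move_eq:
  "learner_move C T t x z = soft_normalize (- (\<Sum>i\<in>{1..<t}. x i) + C *\<^sub>R (\<Sum>i\<in>{t<..T}. z i))"
  by (simp add: learner_move_def soft_normalize_def Let_def)

lemma measurable_soft_normalize [measurable]:
  "soft_normalize \<in> borel_measurable borel"
  by (intro borel_measurable_continuous_onI continuous_intros)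

context online_game
begin

lemma nature_norm_le: "t \<in> {1..T} \<Longrightarrow> \<omega> \<in> space M \<Longrightarrow> norm (X t \<omega>) \<le> 1"
  using nature_ball[of t \<omega>] by simp

lemma distr_draws:
  assumes t: "t \<in> {1..T}"
  shows "distr M (PiM {t<..T} (\<lambda>_. borel)) (\<lambda>\<omega>. \<lambda>i\<in>{t<..T}. Z t i \<omega>)
    = PiM {t<..T} (\<lambda>_. uniform_sphere)"
proof (cases "{t<..T} = {}")
  case True
  \<comment> \<open>Round \<open>T\<close> has no draws, while the product characterization of
    independence used below is for nonempty index sets.\<close>
  have *: "distr M (PiM {} (\<lambda>_. borel)) (\<lambda>\<omega>. \<lambda>i\<in>{}. Z t i \<omega>) = PiM {} (\<lambda>_. uniform_sphere)"
    (is "?P = _")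
  proof (rule PUS.PiM_eqI)
    fix A :: "nat \<Rightarrow> 'a set"
    interpret P: prob_space ?P
      by (intro prob_space_distr measurable_restrict) simp
    have "Pi\<^sub>E {} A = space ?P"
      by (simp add: space_PiM)
    then show "emeasure ?P (Pi\<^sub>E {} A) = (\<Prod>i\<in>{}. emeasure uniform_sphere (A i))"
      by (simp only: P.emeasure_space_1 prod.empty)
  qed (simp_all cong: sets_PiM_cong)
  show ?thesis unfolding True by (rule *)
next
  case False
  then have "distr M (PiM {t<..T} (\<lambda>_. borel)) (\<lambda>\<omega>. \<lambda>i\<in>{t<..T}. Z t i \<omega>)
      = PiM {t<..T} (\<lambda>i. distr M borel (Z t i))"
    by (intro iffD1[OF indep_vars_iff_distr_eq_PiM'] draw_indep draw_random t)
  also have "\<dots> = PiM {t<..T} (\<lambda>_. uniform_sphere)"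
    using draw_law[OF t] by (intro PiM_cong) auto
  finally show ?thesis .
qed

text \<open>The loss of round \<open>t\<close> is a function of the moves up to \<open>t\<close> and
  the fresh draws, so \<open>draw_fresh\<close> is projected to these. An event about the moves is a
  cylinder in the joint history.\<close>

lemma indep_moves_draws:
  assumes t: "t \<in> {1..T}"
  shows "indep_var (PiM {1..t} (\<lambda>_. borel)) (\<lambda>\<omega>. \<lambda>s\<in>{1..t}. X s \<omega>)
    (PiM {t<..T} (\<lambda>_. borel)) (\<lambda>\<omega>. \<lambda>i\<in>{t<..T}. Z t i \<omega>)"
  unfolding indep_var_eq
proof (intro conjI)
  let ?A = "\<lambda>\<omega>. \<lambda>s\<in>{1..t}. X s \<omega>" and ?B = "\<lambda>\<omega>. \<lambda>i\<in>{t<..T}. Z t i \<omega>"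
  let ?H = "\<lambda>\<omega>. \<lambda>p\<in>(SIGMA s:{1..<t}. {s<..T}). Z (fst p) (snd p) \<omega>"
  let ?MA = "PiM {1..t} (\<lambda>_. borel :: 'a measure)" and ?MB = "PiM {t<..T} (\<lambda>_. borel :: 'a measure)"
  let ?MH = "PiM (SIGMA s:{1..<t}. {s<..T}) (\<lambda>_. borel :: 'a measure)"
  let ?VA = "vimage_algebra (space M) (\<lambda>\<omega>. (?A \<omega>, ?H \<omega>)) (?MA \<Otimes>\<^sub>M ?MH)"
  let ?VB = "vimage_algebra (space M) ?B ?MB"
  show A: "random_variable ?MA ?A"
    using t by (intro measurable_restrict nature_random) auto
  show B: "random_variable ?MB ?B"
    by (intro measurable_restrict draw_random t)
  have H: "?H \<in> space M \<rightarrow> space ?MH"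
    by (auto simp: space_PiM)
  have "{?A -` S \<inter> space M | S. S \<in> sets ?MA} \<subseteq> sets ?VA"
  proof safe
    fix S assume "S \<in> sets ?MA"
    then have "S \<times> space ?MH \<in> sets (?MA \<Otimes>\<^sub>M ?MH)" by auto
    then have "(\<lambda>\<omega>. (?A \<omega>, ?H \<omega>)) -` (S \<times> space ?MH) \<inter> space M \<in> sets ?VA"
      by (rule in_vimage_algebra)
    also have "(\<lambda>\<omega>. (?A \<omega>, ?H \<omega>)) -` (S \<times> space ?MH) \<inter> space M = ?A -` S \<inter> space M"
      using H by auto
    finally show "?A -` S \<inter> space M \<in> sets ?VA" .
  qed
  then have SA: "sigma_sets (space M) {?A -` S \<inter> space M | S. S \<in> sets ?MA} \<subseteq> sets ?VA"
    using sets.sigma_sets_subset[of _ ?VA] by simp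
  have "{?B -` S \<inter> space M | S. S \<in> sets ?MB} \<subseteq> sets ?VB"
    by (auto intro: in_vimage_algebra)
  then have SB: "sigma_sets (space M) {?B -` S \<inter> space M | S. S \<in> sets ?MB} \<subseteq> sets ?VB"
    using sets.sigma_sets_subset[of _ ?VB] by simp
  show "indep_set (sigma_sets (space M) {?A -` S \<inter> space M | S. S \<in> sets ?MA})
      (sigma_sets (space M) {?B -` S \<inter> space M | S. S \<in> sets ?MB})"
    unfolding indep_set_def using SA SB
    by (intro indep_sets_mono_sets[OF draw_fresh[OF t, unfolded indep_set_def]]) (auto split: bool.split)
qed

text \<open>The joint law of moves and fresh draws is a product, so Fubini integrates the draws out
  with the moves held fixed. The bound is asked only at attained moves, because the loss is bounded
  only for moves in the ball.\<close>

lemma integral_fresh_draws: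
  fixes h :: "(nat \<Rightarrow> 'a) \<Rightarrow> (nat \<Rightarrow> 'a) \<Rightarrow> real"
  assumes t: "t \<in> {1..T}"
    and h: "case_prod h \<in> borel_measurable (PiM {1..t} (\<lambda>_. borel) \<Otimes>\<^sub>M PiM {t<..T} (\<lambda>_. borel))"
    and bound: "\<And>\<omega> z. \<omega> \<in> space M \<Longrightarrow> \<bar>h (\<lambda>s\<in>{1..t}. X s \<omega>) z\<bar> \<le> B"
  shows "(\<integral>\<omega>. h (\<lambda>s\<in>{1..t}. X s \<omega>) (\<lambda>i\<in>{t<..T}. Z t i \<omega>) \<partial>M)
      = (\<integral>\<omega>. (\<integral>z. h (\<lambda>s\<in>{1..t}. X s \<omega>) z \<partial>PiM {t<..T} (\<lambda>_. uniform_sphere)) \<partial>M)"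
    and "integrable M (\<lambda>\<omega>. h (\<lambda>s\<in>{1..t}. X s \<omega>) (\<lambda>i\<in>{t<..T}. Z t i \<omega>))"
    and "integrable M (\<lambda>\<omega>. \<integral>z. h (\<lambda>s\<in>{1..t}. X s \<omega>) z \<partial>PiM {t<..T} (\<lambda>_. uniform_sphere))"
proof -
  let ?A = "\<lambda>\<omega>. \<lambda>s\<in>{1..t}. X s \<omega>" and ?B = "\<lambda>\<omega>. \<lambda>i\<in>{t<..T}. Z t i \<omega>"
  let ?MA = "PiM {1..t} (\<lambda>_. borel :: 'a measure)" and ?MB = "PiM {t<..T} (\<lambda>_. borel :: 'a measure)"
  let ?D = "PiM {t<..T} (\<lambda>_. uniform_sphere :: 'a measure)"
  have A [measurable]: "?A \<in> M \<rightarrow>\<^sub>M ?MA"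
    using t by (intro measurable_restrict nature_random) auto
  have B [measurable]: "?B \<in> M \<rightarrow>\<^sub>M ?MB"
    by (intro measurable_restrict draw_random t)
  note AB = measurable_Pair[OF A B]
  interpret DA: prob_space "distr M ?MA ?A" by (rule prob_space_distr) (rule A)
  interpret DB: prob_space ?D by (rule prob_space_PiM) (rule prob_space_uniform_sphere)
  interpret P: pair_prob_space "distr M ?MA ?A" ?D ..
  have joint: "distr M (?MA \<Otimes>\<^sub>M ?MB) (\<lambda>\<omega>. (?A \<omega>, ?B \<omega>)) = distr M ?MA ?A \<Otimes>\<^sub>M ?D"
    using indep_moves_draws[OF t] unfolding indep_var_distribution_eq distr_draws[OF t] by simp
  show int: "integrable M (\<lambda>\<omega>. h (?A \<omega>) (?B \<omega>))"
  proof (rule integrable_const_bound[where B=B])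
    show "AE \<omega> in M. norm (h (?A \<omega>) (?B \<omega>)) \<le> B"
      using bound by (auto intro!: AE_I2)
    show "(\<lambda>\<omega>. h (?A \<omega>) (?B \<omega>)) \<in> borel_measurable M"
      using measurable_compose[OF AB h] by simp
  qed
  then have "integrable (distr M (?MA \<Otimes>\<^sub>M ?MB) (\<lambda>\<omega>. (?A \<omega>, ?B \<omega>))) (case_prod h)"
    by (intro iffD2[OF integrable_distr_eq[OF AB h]]) simp
  then have int': "integrable (distr M ?MA ?A \<Otimes>\<^sub>M ?D) (case_prod h)"
    unfolding joint .
  from P.integrable_fst'[OF int'] have int_fst: "integrable (distr M ?MA ?A) (\<lambda>a. \<integral>z. h a z \<partial>?D)"
    by simp
  have meas: "(\<lambda>a. \<integral>z. h a z \<partial>?D) \<in> borel_measurable ?MA"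
    using borel_measurable_integrable[OF int_fst] by simp
  show "integrable M (\<lambda>\<omega>. \<integral>z. h (?A \<omega>) z \<partial>?D)"
    using int_fst by (rule iffD1[OF integrable_distr_eq[OF A meas]])
  have "(\<integral>\<omega>. h (?A \<omega>) (?B \<omega>) \<partial>M)
      = (\<integral>p. case_prod h p \<partial>distr M (?MA \<Otimes>\<^sub>M ?MB) (\<lambda>\<omega>. (?A \<omega>, ?B \<omega>)))"
    using integral_distr[OF AB h] by simp
  also have "\<dots> = (\<integral>a. (\<integral>z. h a z \<partial>?D) \<partial>distr M ?MA ?A)"
    unfolding joint using P.integral_fst'[OF int'] by simp
  also have "\<dots> = (\<integral>\<omega>. (\<integral>z. h (?A \<omega>) z \<partial>?D) \<partial>M)"
    by (rule integral_distr[OF A meas])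
  finally show "(\<integral>\<omega>. h (?A \<omega>) (?B \<omega>) \<partial>M) = (\<integral>\<omega>. (\<integral>z. h (?A \<omega>) z \<partial>?D) \<partial>M)" .
qed

lemma integral_learner_loss:
  fixes C :: real
  assumes t: "t \<in> {1..T}"
  defines "loss \<equiv> \<lambda>\<omega>. learner_move C T t (\<lambda>i. X i \<omega>) (\<lambda>i. Z t i \<omega>) \<bullet> X t \<omega>"
    and "mean_loss \<equiv> \<lambda>\<omega>. walk {t<..T} (\<lambda>z. soft_normalize (- (\<Sum>i\<in>{1..<t}. X i \<omega>) + C *\<^sub>R z) \<bullet> X t \<omega>)"
  shows "(\<integral>\<omega>. loss \<omega> \<partial>M) = (\<integral>\<omega>. mean_loss \<omega> \<partial>M)" and "integrable M loss" and "integrable M mean_loss"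
proof -
  define h where "h a z =
    soft_normalize (- (\<Sum>i\<in>{1..<t}. a i) + C *\<^sub>R (\<Sum>i\<in>{t<..T}. z i)) \<bullet> a t" for a z :: "nat \<Rightarrow> 'a"
  have sum_X: "(\<Sum>i\<in>{1..<t}. (\<lambda>s\<in>{1..t}. X s \<omega>) i) = (\<Sum>i\<in>{1..<t}. X i \<omega>)" for \<omega>
    by (rule sum.cong) auto
  have sum_Z: "(\<Sum>i\<in>{t<..T}. (\<lambda>s\<in>{t<..T}. Z t s \<omega>) i) = (\<Sum>i\<in>{t<..T}. Z t i \<omega>)" for \<omega>
    by (rule sum.cong) auto
  have X_t: "(\<lambda>s\<in>{1..t}. X s \<omega>) t = X t \<omega>" for \<omega>
    using t by simp
  have loss: "loss = (\<lambda>\<omega>. h (\<lambda>s\<in>{1..t}. X s \<omega>) (\<lambda>i\<in>{t<..T}. Z t i \<omega>))"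
    unfolding loss_def h_def learner_move_eq sum_X sum_Z X_t ..
  have mean_loss: "mean_loss
      = (\<lambda>\<omega>. \<integral>z. h (\<lambda>s\<in>{1..t}. X s \<omega>) z \<partial>PiM {t<..T} (\<lambda>_. uniform_sphere))"
    unfolding mean_loss_def h_def walk_def sum_X X_t ..
  let ?N = "PiM {1..t} (\<lambda>_. borel :: 'a measure) \<Otimes>\<^sub>M PiM {t<..T} (\<lambda>_. borel :: 'a measure)"
  have fst_meas: "(\<lambda>p. fst p i) \<in> borel_measurable ?N" if "i \<in> {1..t}" for i
    by (rule measurable_compose[OF measurable_fst measurable_component_singleton[OF that]])
  have snd_meas: "(\<lambda>p. snd p i) \<in> borel_measurable ?N" if "i \<in> {t<..T}" for i
    by (rule measurable_compose[OF measurable_snd measurable_component_singleton[OF that]])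
  have meas: "case_prod h \<in> borel_measurable ?N"
    unfolding h_def case_prod_beta using t
    by (intro borel_measurable_inner measurable_compose[OF _ measurable_soft_normalize]
        borel_measurable_add borel_measurable_uminus borel_measurable_sum borel_measurable_scaleR
        borel_measurable_const fst_meas snd_meas) auto
  have bound: "\<bar>h (\<lambda>s\<in>{1..t}. X s \<omega>) z\<bar> \<le> 1" if "\<omega> \<in> space M" for \<omega> z
  proof -
    have "\<bar>h (\<lambda>s\<in>{1..t}. X s \<omega>) z\<bar> \<le> 1 * norm (X t \<omega>)"
      unfolding h_def using t
      by (intro order_trans[OF Cauchy_Schwarz_ineq2] mult_mono norm_soft_normalize_le) auto
    then show ?thesis using nature_norm_le[OF t that] by simp
  qed
  show "(\<integral>\<omega>. loss \<omega> \<partial>M) = (\<integral>\<omega>. mean_loss \<omega> \<partial>M)" "integrable M loss" "integrable M mean_loss"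
    unfolding loss mean_loss by (rule integral_fresh_draws[OF t meas bound]; assumption)+
qed

text \<open>Linearity of expectation treats the rounds separately. Once the draws are integrated
  out, each outcome sees a fixed sequence of moves, so the bound for fixed sequences applies to
  adaptive opponents.\<close>

lemma expected_regret_le:
  assumes path: "\<And>x :: nat \<Rightarrow> 'a. (\<And>t. t \<in> {1..T} \<Longrightarrow> norm (x t) \<le> 1) \<Longrightarrow>
    (\<Sum>t\<in>{1..T}. walk {t<..T} (\<lambda>z. soft_normalize (- (\<Sum>i\<in>{1..<t}. x i) + C *\<^sub>R z) \<bullet> x t))
      + norm (\<Sum>t\<in>{1..T}. x t) \<le> R"
  shows "(\<integral>\<omega>. regret T (\<lambda>t. learner_move C T t (\<lambda>i. X i \<omega>) (\<lambda>i. Z t i \<omega>))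
    (\<lambda>t. X t \<omega>) (cball 0 1) \<partial>M) \<le> R"
proof -
  let ?loss = "\<lambda>t \<omega>. learner_move C T t (\<lambda>i. X i \<omega>) (\<lambda>i. Z t i \<omega>) \<bullet> X t \<omega>"
  let ?mean = "\<lambda>t \<omega>. walk {t<..T} (\<lambda>z. soft_normalize (- (\<Sum>i\<in>{1..<t}. X i \<omega>) + C *\<^sub>R z) \<bullet> X t \<omega>)"
  let ?norm = "\<lambda>\<omega>. norm (\<Sum>t\<in>{1..T}. X t \<omega>)"
  have norm: "integrable M ?norm"
  proof (rule integrable_const_bound[where B="real T"])
    show "AE \<omega> in M. norm (?norm \<omega>) \<le> real T"
    proof (rule AE_I2)
      fix \<omega> assume \<omega>: "\<omega> \<in> space M"
      have "?norm \<omega> \<le> (\<Sum>t\<in>{1..T}. 1)"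
        using \<omega> by (intro sum_norm_le nature_norm_le)
      then show "norm (?norm \<omega>) \<le> real T" by simp
    qed
    show "?norm \<in> borel_measurable M"
    proof -
      have [measurable]: "(\<lambda>\<omega>. \<Sum>t\<in>{1..T}. X t \<omega>) \<in> borel_measurable M"
        by (rule borel_measurable_sum) (rule nature_random)
      show ?thesis by measurable
    qed
  qed
  have loss: "integrable M (\<lambda>\<omega>. \<Sum>t\<in>{1..T}. ?loss t \<omega>)"
    by (rule Bochner_Integration.integrable_sum) (rule integral_learner_loss(2))
  have mean: "integrable M (\<lambda>\<omega>. \<Sum>t\<in>{1..T}. ?mean t \<omega>)"
    by (rule Bochner_Integration.integrable_sum) (rule integral_learner_loss(3))
  have "(\<integral>\<omega>. regret T (\<lambda>t. learner_move C T t (\<lambda>i. X i \<omega>) (\<lambda>i. Z t i \<omega>))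
      (\<lambda>t. X t \<omega>) (cball 0 1) \<partial>M) = (\<integral>\<omega>. (\<Sum>t\<in>{1..T}. ?loss t \<omega>) + ?norm \<omega> \<partial>M)"
    by (simp only: regret_cball)
  also have "\<dots> = (\<Sum>t\<in>{1..T}. \<integral>\<omega>. ?loss t \<omega> \<partial>M) + (\<integral>\<omega>. ?norm \<omega> \<partial>M)"
    unfolding Bochner_Integration.integral_add[OF loss norm]
    by (subst Bochner_Integration.integral_sum) (rule integral_learner_loss(2), assumption, rule refl)
  also have "(\<Sum>t\<in>{1..T}. \<integral>\<omega>. ?loss t \<omega> \<partial>M) = (\<Sum>t\<in>{1..T}. \<integral>\<omega>. ?mean t \<omega> \<partial>M)"
    by (intro sum.cong refl integral_learner_loss(1))
  also have "\<dots> + (\<integral>\<omega>. ?norm \<omega> \<partial>M) = (\<integral>\<omega>. (\<Sum>t\<in>{1..T}. ?mean t \<omega>) + ?norm \<omega> \<partial>M)"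
    unfolding Bochner_Integration.integral_add[OF mean norm]
    by (subst Bochner_Integration.integral_sum) (rule integral_learner_loss(3), assumption, rule refl)
  also have "\<dots> \<le> (\<integral>\<omega>. R \<partial>M)"
  proof (rule integral_mono)
    show "integrable M (\<lambda>\<omega>. (\<Sum>t\<in>{1..T}. ?mean t \<omega>) + ?norm \<omega>)"
      using mean norm by (rule Bochner_Integration.integrable_add)
    show "(\<Sum>t\<in>{1..T}. ?mean t \<omega>) + ?norm \<omega> \<le> R" if "\<omega> \<in> space M" for \<omega>
      by (rule path) (rule nature_norm_le[OF _ that])
  qed simp
  finally show ?thesis by (simp add: prob_space)
qed

end

theorem lemma16:
  fixes M :: "'w measure"
    and T :: nat
    and X :: "nat \<Rightarrow> 'w \<Rightarrow> 'a::euclidean_space"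
    and Z :: "nat \<Rightarrow> nat \<Rightarrow> 'w \<Rightarrow> 'a"
    and C :: real
  assumes "online_game M T X Z"
    and "C = 4 * sqrt 2"
  shows "(\<integral>\<omega>. regret T (\<lambda>t. learner_move C T t (\<lambda>i. X i \<omega>) (\<lambda>i. Z t i \<omega>))
                 (\<lambda>t. X t \<omega>) (cball 0 1) \<partial>M)
           \<le> C * (\<integral>x. norm (\<Sum>t\<in>{1..T}. x t) \<partial>PiM {1..T} (\<lambda>_. uniform_sphere :: 'a measure))
       \<and> C * (\<integral>x. norm (\<Sum>t\<in>{1..T}. x t) \<partial>PiM {1..T} (\<lambda>_. uniform_sphere :: 'a measure))
           \<le> 4 * sqrt (2 * real T)"
proof
  interpret online_game M T X Z by fact
  have C: "C\<^sup>2 = 32" "0 < C"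
    using assms(2) by (simp_all add: power_mult_distrib)
  have "(\<integral>\<omega>. regret T (\<lambda>t. learner_move C T t (\<lambda>i. X i \<omega>) (\<lambda>i. Z t i \<omega>))
      (\<lambda>t. X t \<omega>) (cball 0 1) \<partial>M) \<le> C * walk {1..T} (norm :: 'a \<Rightarrow> real)"
  \<comment> \<open>The two potentials give the same bound; only here are the dimensions brought
    together.\<close>
  proof (cases "DIM('a) = 1")
    case True
    show ?thesis
      by (rule expected_regret_le) (rule path_regret_one_dim[OF True C])
  next
    case False
    then have "2 \<le> DIM('a)" using DIM_positive[where 'a='a] by linarith
    have "4 \<le> C\<^sup>2" "0 \<le> C" using C by simp_all
    note high_dim = path_regret_high_dim[OF \<open>2 \<le> DIM('a)\<close> this]
    show ?thesis
      by (rule expected_regret_le) (rule high_dim)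
  qed
  then show "(\<integral>\<omega>. regret T (\<lambda>t. learner_move C T t (\<lambda>i. X i \<omega>) (\<lambda>i. Z t i \<omega>))
                 (\<lambda>t. X t \<omega>) (cball 0 1) \<partial>M)
           \<le> C * (\<integral>x. norm (\<Sum>t\<in>{1..T}. x t) \<partial>PiM {1..T} (\<lambda>_. uniform_sphere :: 'a measure))"
    by (simp add: walk_def)
  have "C * walk {1..T} (norm :: 'a \<Rightarrow> real) \<le> C * sqrt (card {1..T})"
    using C by (intro mult_left_mono walk_norm_le) auto
  also have "\<dots> = 4 * sqrt (2 * real T)"
    using assms(2) by (simp add: real_sqrt_mult)
  finally show "C * (\<integral>x. norm (\<Sum>t\<in>{1..T}. x t) \<partial>PiM {1..T} (\<lambda>_. uniform_sphere :: 'a measure))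
           \<le> 4 * sqrt (2 * real T)"
    by (simp add: walk_def)
qed

end
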